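(* Let $R>0$ and let $L=2\pi R$ be the circumference of the circular filament. The estimate (E) for the third component of the perturbation (stated in the context) is optimal in the following sense. There exists $C>0$ such that for any integer $n\ge2$, the solution $\boldsymbol{x}_n={}^t(x_{n,1},x_{n,2},x_{n,3})$ of problem (C) (stated in the context) with the initial perturbation $\boldsymbol{\varphi}_0=\boldsymbol{\varphi}_n$ given by $$\boldsymbol{\varphi}_n(s)={}^t\big(R_n\cos(\tfrac{s}{R_n})-R\cos(\tfrac sR),\ R_n\sin(\tfrac{s}{R_n})-R\sin(\tfrac sR),\ 0\big),\qquad R_n=\frac Rn,$$ satisfies $$|x_{n,3}(s,t)-x^R_3(s,t)|=Cnt$$ for all $s\in\mathbf{T}$ and $t\ge0$, where $x^R_3$ is the third component of $\boldsymbol{x}^R$.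
   Context: Subscripts $s,t$ denote differentiation; $\times$ is the cross product in $\mathbf{R}^3$. $\mathbf{T}$ is the circle of length $L=2\pi R$ (functions on $\mathbf{T}$ are identified with $L$-periodic functions). $H^m(\mathbf{T})$ is the usual $L^2$-based Sobolev space and $\|\cdot\|$ is the $L^2(\mathbf{T})$ norm. The circular filament and its initial state are $$\boldsymbol{x}^R(s,t)={}^t\big(R\cos(\tfrac sR),R\sin(\tfrac sR),\tfrac tR\big),\qquad \boldsymbol{x}^R_0(s)={}^t\big(R\cos(\tfrac sR),R\sin(\tfrac sR),0\big).$$ Problem (C): $\boldsymbol{x}_t=\boldsymbol{x}_s\times\boldsymbol{x}_{ss}$ for $s\in\mathbf{T}$, $t>0$, with $\boldsymbol{x}(s,0)=\boldsymbol{x}^R_0(s)+\boldsymbol{\varphi}_0(s)$ for $s\in\mathbf{T}$. It is known (Tani–Nishiyama) that for any $\boldsymbol{\varphi}_0\in H^4(\mathbf{T})$ with $|\boldsymbol{x}^R_{0s}+\boldsymbol{\varphi}_{0s}|=1$ on $\mathbf{T}$ there is a unique time-global solution $\boldsymbol{x}$ with $|\boldsymbol{x}_s|=1$, $\boldsymbol{x}\in\bigcap_{j=0}^2C^j([0,\infty);H^{4-2j}(\mathbf{T}))$ and $\boldsymbol{x}_s\in L^\infty(0,\infty;H^3(\mathbf{T}))$; "the solution" refers to this one. Write $\boldsymbol{\varphi}=\boldsymbol{x}-\boldsymbol{x}^R={}^t(\varphi_1,\varphi_2,\varphi_3)$, and let $\varphi_{0,3}$ be the third component of $\boldsymbol{\varphi}_0$.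 For an integer $k\ge3$, $\boldsymbol{\varphi}_0\in H^4(\mathbf{T})$ satisfies the $k$-reflective property if there exist $0\le s_1<s_2<\cdots<s_k<L$ such that (i) $\boldsymbol{\varphi}_{0s}(s_j)=\boldsymbol{0}$ for all $j\in\{1,\ldots,k\}$; and (ii) with $I_j=[s_j,s_{j+1}]$ for $j\in\{1,\ldots,k\}$, where $s_{k+1}=s_1+L$, and $I_{k+1}=[s_1+L,s_2+L]$, for all $j\in\{2,\ldots,k+1\}$ the restriction of $\boldsymbol{\varphi}_0$ to $I_{j-1}\cup I_j$ has reflection symmetry with respect to the plane perpendicular to ${}^t(-\sin(\frac{s_j}{R}),\cos(\frac{s_j}{R}),0)$. Estimate (E): for any integer $k\ge3$ and any $\boldsymbol{\varphi}_0\in H^4(\mathbf{T})$ satisfying $|\boldsymbol{x}^R_{0s}+\boldsymbol{\varphi}_{0s}|=1$ on $\mathbf{T}$ and the $k$-reflective property, there exists a constant $C>0$ such that for any $t>0$, $$\|\varphi_3(t)\|\le C\big(\|\varphi_{0,3}\|+\|\boldsymbol{\varphi}_{0ss}\|+\|\boldsymbol{\varphi}_{0ss}\|^2t\big).$$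
   Formalization: The equality proved is |x_{n,3} − x^R_3| = C(n−1)t instead of Cnt: the solution is the circle of radius R/n rising at speed n/R, so the gap is (n−1)t/R, and no single C gives Cnt for both n=2 and n=3. Existence of the solution is taken as known. *)

theory Defs
  imports "HOL-Analysis.Analysis"
begin

unbundle cross3_syntax

text \<open>The circle of length \<open>L\<close>: functions on it are \<open>L\<close>-periodic functions on the line, and integrals
  over it are taken over the period \<open>{0..L}\<close>.\<close>

definition periodic :: "real \<Rightarrow> (real \<Rightarrow> 'a) \<Rightarrow> bool" where
  "periodic L f \<longleftrightarrow> (\<forall>s. f (s + L) = f s)"

definition L2_circle :: "real \<Rightarrow> (real \<Rightarrow> 'a::euclidean_space) set" where
  "L2_circle L = {f. periodic L f \<and> f \<in> borel_measurable (lebesgue_on {0..L}) \<and>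
     integrable (lebesgue_on {0..L}) (\<lambda>s. (norm (f s))\<^sup>2)}"

definition L2_circle_norm :: "real \<Rightarrow> (real \<Rightarrow> 'a::euclidean_space) \<Rightarrow> real" where
  "L2_circle_norm L f = sqrt (integral\<^sup>L (lebesgue_on {0..L}) (\<lambda>s. (norm (f s))\<^sup>2))"

definition smooth_periodic :: "real \<Rightarrow> (real \<Rightarrow> real) \<Rightarrow> bool" where
  "smooth_periodic L \<psi> \<longleftrightarrow> periodic L \<psi> \<and> (\<forall>k s. (deriv ^^ k) \<psi> differentiable (at s))"

definition is_weak_deriv ::
    "real \<Rightarrow> nat \<Rightarrow> (real \<Rightarrow> 'a::euclidean_space) \<Rightarrow> (real \<Rightarrow> 'a) \<Rightarrow> bool" where
  "is_weak_deriv L k f g \<longleftrightarrow> g \<in> L2_circle L \<and>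
     (\<forall>\<psi>. smooth_periodic L \<psi> \<longrightarrow>
        integral\<^sup>L (lebesgue_on {0..L}) (\<lambda>s. (deriv ^^ k) \<psi> s *\<^sub>R f s) =
        (-1) ^ k *\<^sub>R integral\<^sup>L (lebesgue_on {0..L}) (\<lambda>s. \<psi> s *\<^sub>R g s))"

text \<open>Members of \<open>H\<^sup>m\<close> are functions, not classes modulo null sets; the norm below does not
  depend on the choice of the weak derivatives, which are unique almost everywhere.\<close>

definition Sobolev :: "real \<Rightarrow> nat \<Rightarrow> (real \<Rightarrow> 'a::euclidean_space) set" where
  "Sobolev L m = {f \<in> L2_circle L. \<forall>k\<le>m. \<exists>g. is_weak_deriv L k f g}"

definition Sobolev_norm :: "real \<Rightarrow> nat \<Rightarrow> (real \<Rightarrow> 'a::euclidean_space) \<Rightarrow> real" where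
  "Sobolev_norm L m f =
     sqrt (\<Sum>k\<le>m. (L2_circle_norm L (SOME g. is_weak_deriv L k f g))\<^sup>2)"

text \<open>\<open>C_Sobolev L m j u\<close> expresses that \<open>u\<close> lies in \<open>C\<^sup>j([0,\<infinity>); H\<^sup>m)\<close>; time derivatives are
  limits of difference quotients in the norm of \<open>H\<^sup>m\<close>, one-sided at time 0.\<close>

definition Sobolev_continuous :: "real \<Rightarrow> nat \<Rightarrow> (real \<Rightarrow> real \<Rightarrow> 'a::euclidean_space) \<Rightarrow> bool" where
  "Sobolev_continuous L m u \<longleftrightarrow>
     (\<forall>t\<ge>0. u t \<in> Sobolev L m) \<and>
     (\<forall>t\<ge>0. ((\<lambda>\<tau>. Sobolev_norm L m (\<lambda>s. u \<tau> s - u t s)) \<longlongrightarrow> 0) (at t within {0..}))"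

definition Sobolev_derivative ::
    "real \<Rightarrow> nat \<Rightarrow> (real \<Rightarrow> real \<Rightarrow> 'a::euclidean_space) \<Rightarrow> (real \<Rightarrow> real \<Rightarrow> 'a) \<Rightarrow> bool" where
  "Sobolev_derivative L m u v \<longleftrightarrow>
     (\<forall>t\<ge>0. ((\<lambda>\<tau>. Sobolev_norm L m (\<lambda>s. (u \<tau> s - u t s) /\<^sub>R (\<tau> - t) - v t s)) \<longlongrightarrow> 0)
        (at t within {0..}))"

primrec C_Sobolev :: "real \<Rightarrow> nat \<Rightarrow> nat \<Rightarrow> (real \<Rightarrow> real \<Rightarrow> 'a::euclidean_space) \<Rightarrow> bool" where
  "C_Sobolev L m 0 = (\<lambda>u. Sobolev_continuous L m u)"
| "C_Sobolev L m (Suc j) =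
     (\<lambda>u. Sobolev_continuous L m u \<and> (\<exists>v. C_Sobolev L m j v \<and> Sobolev_derivative L m u v))"

definition D\<^sub>s :: "(real \<Rightarrow> real \<Rightarrow> 'a::real_normed_vector) \<Rightarrow> real \<Rightarrow> real \<Rightarrow> 'a" where
  "D\<^sub>s x s t = vector_derivative (\<lambda>\<sigma>. x \<sigma> t) (at s)"

definition circle_filament :: "real \<Rightarrow> real \<Rightarrow> real \<Rightarrow> real^3" where
  "circle_filament R s t = vector [R * cos (s / R), R * sin (s / R), t / R]"

text \<open>The global solution \<open>x s t\<close> of the vortex filament equation in the Tani--Nishiyama class.
  For every \<open>t \<ge> 0\<close> the function \<open>x(\<cdot>,t)\<close> is taken to be the continuous representative of its class in
  \<open>H\<^sup>4\<close>; it is then three times continuously differentiable in \<open>s\<close>, so \<open>D\<^sub>s x\<close> and \<open>D\<^sub>s (D\<^sub>s x)\<close> are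
  classical derivatives. As \<open>x \<in> C([0,\<infinity>); H\<^sup>4)\<close>, measurability of \<open>D\<^sub>s x\<close> as a function of time into
  \<open>H\<^sup>3\<close> is automatic, and only the essential bound has to be required.\<close>

definition is_solution :: "real \<Rightarrow> (real \<Rightarrow> real^3) \<Rightarrow> (real \<Rightarrow> real \<Rightarrow> real^3) \<Rightarrow> bool" where
  "is_solution R \<phi>\<^sub>0 x \<longleftrightarrow>
     (let L = 2 * pi * R in
       (\<forall>t\<ge>0. continuous_on UNIV (\<lambda>s. x s t)) \<and>
       (\<forall>j\<le>2. C_Sobolev L (4 - 2 * j) j (\<lambda>t s. x s t)) \<and>
       (\<exists>B. AE t in lebesgue_on {0<..}.
          (\<lambda>s. D\<^sub>s x s t) \<in> Sobolev L 3 \<and> Sobolev_norm L 3 (\<lambda>s. D\<^sub>s x s t) \<le> B) \<and>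
       (\<forall>s. \<forall>t\<ge>0. norm (D\<^sub>s x s t) = 1) \<and>
       (\<forall>s. \<forall>t>0. ((\<lambda>\<tau>. x s \<tau>) has_vector_derivative D\<^sub>s x s t \<times> D\<^sub>s (D\<^sub>s x) s t) (at t)) \<and>
       (\<forall>s. x s 0 = circle_filament R s 0 + \<phi>\<^sub>0 s))"

text \<open>Adding the perturbation below to the initial circle of radius \<open>R\<close> gives the circle of radius
  \<open>R/n\<close>, run through \<open>n\<close> times. Its solution is \<open>circle_filament (R/n)\<close>, at height \<open>n t/R\<close>, so
  the gap to the height \<open>t/R\<close> of \<open>circle_filament R\<close> is exactly \<open>(n - 1) t/R\<close>. With a constant
  \<open>C\<close> independent of \<open>n\<close> the gap therefore equals \<open>C (n - 1) t\<close>, which lies between \<open>(C/2) n t\<close> and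
  \<open>C n t\<close> for \<open>n \<ge> 2\<close>; it is not of the form \<open>C n t\<close> for all \<open>n\<close> simultaneously.\<close>

definition initial_perturbation :: "real \<Rightarrow> nat \<Rightarrow> real \<Rightarrow> real^3" where
  "initial_perturbation R n s =
     (let R\<^sub>n = R / real n in
       vector [R\<^sub>n * cos (s / R\<^sub>n) - R * cos (s / R), R\<^sub>n * sin (s / R\<^sub>n) - R * sin (s / R), 0])"

end

theory Submission
  imports Defs
begin

text \<open>
  The circle of radius \<open>r = R / n\<close>, run through \<open>n\<close> times and translated upwards with constant
  velocity \<open>1 / r\<close>, is one solution with the given initial data, and its height differs from
  \<open>t / R\<close> by \<open>(n - 1) t / R\<close>. So \<open>C = 1 / R\<close>, and the whole content of the theorem is that every
  solution in the given class coincides with this one.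

  Let \<open>a\<close>, \<open>b\<close>, \<open>c\<close> be the first three \<open>s\<close>-derivatives of a solution \<open>x\<close>, and let \<open>u\<close> be the tangent
  of the circle, with \<open>u' = v / r\<close> and \<open>v' = - u / r\<close>. Differentiating the equation gives
  \<open>a_t = a \<times> c\<close>. Two facts make uniqueness short.

  \<^item> The energy \<open>\<integral> |b|\<^sup>2\<close> is conserved (\<open>energy_conservation\<close>), so it stays equal to that
    of the circle. Because \<open>u'' = - u / r\<^sup>2\<close> and both tangents have
    length one, this turns into the identity
    \<open>\<integral> |b - u'|\<^sup>2 = r\<^sup>-\<^sup>2 \<integral> |a - u|\<^sup>2\<close>: the distance of the curvatures is controlled, without any
    loss of derivatives, by the distance of the tangents.
  \<^item> The derivative of \<open>Z = \<integral> |a - u|\<^sup>2\<close> is \<open>2 \<integral> u' \<bullet> (a \<times> b)\<close>. Expanded around the circle, the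
    terms of order zero vanish pointwise, and the linear terms integrate to zero because \<open>u \<times> v\<close> is
    the constant vertical vector. What remains is quadratic, at most
    \<open>(2 / r) \<integral> |a - u| |b - u'|\<close>, hence at most \<open>(2 / r\<^sup>2) Z\<close>.

  Gronwall's inequality and \<open>Z(0) = 0\<close> then force \<open>a = u\<close> for all times (\<open>circle_tangent_unique\<close>),
  and the equation \<open>x_t = a \<times> b\<close> can be integrated.

  The argument is carried out with classical derivatives, which come from \<open>x\<close> being a continuous
  curve in \<open>H\<^sup>4\<close>. A continuous function with a weak fourth derivative in \<open>L\<^sup>2\<close> is \<open>C\<^sup>3\<close>, with bounds by the
  Sobolev norm (\<open>Sobolev_embedding\<close>); applied to the differences \<open>x(\<tau>) - x(t)\<close>, this makes
  \<open>x, a, b, c\<close> jointly continuous in \<open>s\<close> and \<open>t\<close> (\<open>Sobolev_continuous_imp_C3\<close>). The embedding is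
  obtained from the \<open>L\<^sup>2\<close> derivative by repeatedly taking primitives of mean zero, and the only
  ambiguity left is a function whose fourth weak derivative vanishes. Such a function is constant,
  since trigonometric polynomials are dense in the continuous functions on the circle.
\<close>

section \<open>Periodic functions and functions on the unit circle\<close>

lemma periodicD: "periodic L f \<Longrightarrow> f (s + L) = f s"
  by (simp add: periodic_def)

lemma periodic_eqI:
  assumes "0 < L" "periodic L f" "periodic L g" "\<And>s. s \<in> {0..L} \<Longrightarrow> f s = g s"
  shows "f s = g s"
proof -
  have *: "h (s + real_of_int k * L) = h s" if "periodic L h" for h :: "real \<Rightarrow> 'a" and k s
  proof -
    have nat: "h (s + real n * L) = h s" for n s
    proof (induction n)
      case (Suc n)
      have "h (s + real (Suc n) * L) = h ((s + real n * L) + L)" by (simp add: algebra_simps)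
      then show ?case using Suc that by (simp add: periodic_def)
    qed simp
    show ?thesis
    proof (cases "k \<ge> 0")
      case True then show ?thesis using nat[of s "nat k"] by simp
    next
      case False then show ?thesis using nat[of "s + real_of_int k * L" "nat (-k)"] by (simp add: algebra_simps)
    qed
  qed
  define k where "k = \<lfloor>s / L\<rfloor>"
  have "real_of_int k \<le> s / L" "s / L < real_of_int k + 1" by (simp_all add: k_def)
  then have "s + real_of_int (-k) * L \<in> {0..L}"
    using assms(1) by (simp add: pos_le_divide_eq pos_divide_less_eq algebra_simps)
  then show ?thesis using *[OF assms(2), of s "-k"] *[OF assms(3), of s "-k"] assms(4) by metis
qed

lemma periodic_norm_le:
  fixes h :: "real \<Rightarrow> 'a::real_normed_vector"
  assumes L: "0 < L" and h: "periodic L h" and B: "\<And>s. s \<in> {0..L} \<Longrightarrow> norm (h s) \<le> B"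
  shows "norm (h s) \<le> B"
proof -
  have "max (norm (h s)) B = B"
    by (rule periodic_eqI[OF L]) (use h B in \<open>auto simp: periodic_def max_def\<close>)
  then show ?thesis by simp
qed

lemma periodic_bounded:
  fixes h :: "real \<Rightarrow> 'a::real_normed_vector"
  assumes L: "0 < L" and h: "continuous_on UNIV h" "periodic L h"
  obtains B where "\<And>s. norm (h s) \<le> B"
proof -
  have "compact (h ` {0..L})" using h by (intro compact_continuous_image) (auto intro: continuous_on_subset)
  then obtain B where B: "\<And>s. s \<in> {0..L} \<Longrightarrow> norm (h s) \<le> B"
    using compact_imp_bounded bounded_iff by (metis imageI)
  show ?thesis by (rule that) (rule periodic_norm_le[OF L h(2) B])
qed

text \<open>The Stone--Weierstrass theorem speaks about compact sets, so a function on the period interval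
  with equal end values is moved to the unit circle in the complex plane. Continuity at the point
  where the argument jumps is inherited from a general result on loops.\<close>

lemma circle_function:
  fixes k :: "real \<Rightarrow> 'a::real_normed_vector"
  assumes L: "0 < L" and k: "continuous_on {0..L} k" "k 0 = k L"
  obtains F where "continuous_on (sphere 0 1 :: complex set) F"
    "\<And>s. s \<in> {0..L} \<Longrightarrow> F (cis (2 * pi * s / L)) = k s"
proof
  define p where "p = (\<lambda>\<theta>. k (L * \<theta>))"
  define F where "F = p \<circ> (\<lambda>z. Arg2pi z / (2 * pi))"
  have "path p"
    unfolding path_def p_def using L
    by (intro continuous_on_compose2[OF k(1)] continuous_intros) (auto simp: mult_le_cancel_left1)
  then have "homotopic_loops UNIV p p"
    using k(2) by (simp add: homotopic_loops_refl pathstart_def pathfinish_def p_def)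
  then show "continuous_on (sphere 0 1) F"
    unfolding F_def using homotopic_loops_imp_homotopic_circlemaps homotopic_with_imp_continuous by blast
  show "F (cis (2 * pi * s / L)) = k s" if s: "s \<in> {0..L}" for s
  proof (cases "s = L")
    case True
    then show ?thesis using L k(2) Arg2pi_of_real[of 1] by (simp add: F_def p_def)
  next
    case False
    then have "2 * pi * s / L < 2 * pi" using s L by (simp add: field_simps)
    moreover have "0 \<le> 2 * pi * s / L" using s L by simp
    ultimately have "Arg2pi (cis (2 * pi * s / L)) = 2 * pi * s / L"
      by (intro Arg2pi_unique[of 1]) (auto simp: cis_conv_exp)
    then show ?thesis using L by (simp add: F_def p_def)
  qed
qed

lemma cis_periodic: "0 < L \<Longrightarrow> periodic L (\<lambda>s. F (cis (2 * pi * s / L)))"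
  by (auto simp: periodic_def add_divide_distrib ring_distribs simp flip: cis_mult)

lemma periodic_extension:
  fixes k :: "real \<Rightarrow> 'a::real_normed_vector"
  assumes L: "0 < L" and k: "continuous_on {0..L} k" "k 0 = k L"
  obtains h where "continuous_on UNIV h" "periodic L h" "\<And>s. s \<in> {0..L} \<Longrightarrow> h s = k s"
proof -
  from circle_function[OF assms] obtain F where F: "continuous_on (sphere 0 1 :: complex set) F"
    "\<And>s. s \<in> {0..L} \<Longrightarrow> F (cis (2 * pi * s / L)) = k s" by blast
  show ?thesis
  proof
    show "continuous_on UNIV (\<lambda>s. F (cis (2 * pi * s / L)))"
      using L by (intro continuous_on_compose2[OF F(1)] continuous_intros) auto
  qed (use F(2) L in \<open>auto intro: cis_periodic\<close>)
qed

section \<open>Trigonometric polynomials as test functions\<close>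

text \<open>Restrictions of polynomials in \<open>Re z\<close> and \<open>Im z\<close> to the unit circle are the trigonometric
  polynomials. That the class is closed under differentiation is all that is needed to see that
  its members are smooth.\<close>

lemma trig_polynomial_deriv:
  fixes q :: "complex \<Rightarrow> real"
  assumes "real_polynomial_function q"
  shows "\<exists>q'. real_polynomial_function q' \<and>
     (\<forall>s. ((\<lambda>s. q (cis (w * s))) has_real_derivative q' (cis (w * s))) (at s))"
  using assms
proof induction
  case (linear f)
  have "bounded_linear (\<lambda>z. f (\<i> * complex_of_real w * z))"
    using bounded_linear_compose[OF linear bounded_linear_mult_right] by simp
  moreover have "((\<lambda>s. f (cis (w * s))) has_real_derivative f (\<i> * complex_of_real w * cis (w * s))) (at s)" for s
  proof -
    have "((\<lambda>s. cis (w * s)) has_vector_derivative \<i> * complex_of_real w * cis (w * s)) (at s)"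
      unfolding cis_conv_exp
      by (auto intro!: derivative_eq_intros has_vector_derivative_real_field simp: exp_of_real algebra_simps)
    from bounded_linear.has_vector_derivative[OF linear this]
    show ?thesis by (simp add: has_real_derivative_iff_has_vector_derivative)
  qed
  ultimately show ?case by blast
next
  case (const c)
  show ?case by (rule exI[of _ "\<lambda>_. 0"]) auto
next
  case (add f g)
  then obtain f' g' where "real_polynomial_function f'" "real_polynomial_function g'"
    "\<And>s. ((\<lambda>s. f (cis (w * s))) has_real_derivative f' (cis (w * s))) (at s)"
    "\<And>s. ((\<lambda>s. g (cis (w * s))) has_real_derivative g' (cis (w * s))) (at s)" by metis
  then show ?case by (intro exI[of _ "\<lambda>z. f' z + g' z"]) (auto intro!: derivative_eq_intros)
next
  case (mult f g)
  then obtain f' g' where "real_polynomial_function f'" "real_polynomial_function g'"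
    "\<And>s. ((\<lambda>s. f (cis (w * s))) has_real_derivative f' (cis (w * s))) (at s)"
    "\<And>s. ((\<lambda>s. g (cis (w * s))) has_real_derivative g' (cis (w * s))) (at s)" by metis
  with mult show ?case by (intro exI[of _ "\<lambda>z. f z * g' z + f' z * g z"]) (auto intro!: derivative_eq_intros)
qed

lemma trig_polynomial_smooth:
  fixes q :: "complex \<Rightarrow> real"
  assumes "real_polynomial_function q" "0 < L"
  shows "smooth_periodic L (\<lambda>s. q (cis (2 * pi * s / L)))"
proof -
  define w where "w = 2 * pi / L"
  have *: "\<exists>q'. real_polynomial_function q' \<and> (deriv ^^ k) (\<lambda>s. q (cis (w * s))) = (\<lambda>s. q' (cis (w * s)))" for k
  proof (induction k)
    case (Suc k)
    then obtain q1 where q1: "real_polynomial_function q1" "(deriv ^^ k) (\<lambda>s. q (cis (w * s))) = (\<lambda>s. q1 (cis (w * s)))"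
      by blast
    from trig_polynomial_deriv[OF q1(1), of w] obtain q2 where "real_polynomial_function q2"
      "\<And>s. ((\<lambda>s. q1 (cis (w * s))) has_real_derivative q2 (cis (w * s))) (at s)" by blast
    then show ?case using q1 by (intro exI[of _ q2]) (auto intro!: DERIV_imp_deriv)
  qed (use assms in auto)
  have "(deriv ^^ k) (\<lambda>s. q (cis (w * s))) differentiable at s" for k s
    using *[of k] trig_polynomial_deriv[of _ w] by (metis (full_types) real_differentiable_def)
  then show ?thesis using assms cis_periodic[of L q] unfolding smooth_periodic_def w_def by (simp add: mult.commute)
qed

lemma smooth_periodic_dense:
  fixes h :: "real \<Rightarrow> real"
  assumes L: "0 < L" and h: "continuous_on UNIV h" "periodic L h" and e: "0 < e"
  obtains \<psi> where "smooth_periodic L \<psi>" "\<And>s. \<bar>h s - \<psi> s\<bar> < e"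
proof -
  have h': "continuous_on {0..L} h" "h 0 = h L"
    using h continuous_on_subset periodicD[OF h(2), of 0] by auto
  from circle_function[OF L h'] obtain F where F: "continuous_on (sphere 0 1 :: complex set) F"
    "\<And>s. s \<in> {0..L} \<Longrightarrow> F (cis (2 * pi * s / L)) = h s" by blast
  obtain q where q: "real_polynomial_function q" "\<And>z. z \<in> sphere 0 1 \<Longrightarrow> \<bar>F z - q z\<bar> < e"
    using Stone_Weierstrass_real_polynomial_function[OF compact_sphere F(1) e] by blast
  have "h s = F (cis (2 * pi * s / L))" for s
    by (rule periodic_eqI[OF L h(2) cis_periodic[OF L]]) (simp add: F)
  with q that[OF trig_polynomial_smooth[OF q(1) L]] show ?thesis by simp
qed

section \<open>Primitives and integration by parts on the circle\<close>

lemma integral_periodic_derivative: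
  fixes F :: "real \<Rightarrow> 'a::banach"
  assumes "0 < L" "periodic L F" "\<And>s. (F has_vector_derivative f s) (at s)"
  shows "(f has_integral 0) {0..L}"
proof -
  have "(f has_integral (F L - F 0)) {0..L}"
    using assms by (intro fundamental_theorem_of_calculus) (auto intro: has_vector_derivative_at_within)
  then show ?thesis using periodicD[OF assms(2), of 0] by simp
qed

lemma periodic_integration_by_parts:
  fixes F :: "real \<Rightarrow> 'a::real_normed_vector" and G :: "real \<Rightarrow> 'b::real_normed_vector"
    and prod :: "'a \<Rightarrow> 'b \<Rightarrow> 'c::banach"
  assumes L: "0 < L" and prod: "bounded_bilinear prod"
    and F: "periodic L F" "\<And>s. (F has_vector_derivative f s) (at s)" "continuous_on UNIV f"
    and G: "periodic L G" "\<And>s. (G has_vector_derivative g s) (at s)" "continuous_on UNIV g"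
  shows "integral {0..L} (\<lambda>s. prod (F s) (g s)) = - integral {0..L} (\<lambda>s. prod (f s) (G s))"
proof -
  interpret bounded_bilinear prod by fact
  have "periodic L (\<lambda>s. prod (F s) (G s))" using F G by (simp add: periodic_def)
  moreover have "((\<lambda>s. prod (F s) (G s)) has_vector_derivative prod (F s) (g s) + prod (f s) (G s)) (at s)" for s
    by (rule has_vector_derivative[OF F(2) G(2)])
  ultimately have "((\<lambda>s. prod (F s) (g s) + prod (f s) (G s)) has_integral 0) {0..L}"
    by (rule integral_periodic_derivative[OF L])
  moreover have "continuous_on UNIV F" "continuous_on UNIV G"
    using F(2) G(2) by (meson continuous_at_imp_continuous_on has_vector_derivative_continuous)+
  then have "(\<lambda>s. prod (F s) (g s)) integrable_on {0..L}" "(\<lambda>s. prod (f s) (G s)) integrable_on {0..L}"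
    using F(3) G(3)
    by (auto intro!: integrable_continuous_real continuous_on intro: continuous_on_subset)
  ultimately show ?thesis
    by (simp add: integral_unique integral_add eq_neg_iff_add_eq_0 flip: integral_add)
qed

lemma periodic_derivative:
  assumes "periodic L F" "\<And>s. (F has_vector_derivative f s) (at s)"
  shows "periodic L f"
  unfolding periodic_def
proof
  fix s
  have "(F \<circ> (\<lambda>x. x + L) has_vector_derivative 1 *\<^sub>R f (s + L)) (at s)"
    by (rule vector_diff_chain_at) (auto intro!: derivative_eq_intros assms(2))
  moreover have "F \<circ> (\<lambda>x. x + L) = F" using assms(1) by (auto simp: periodic_def)
  ultimately have "(F has_vector_derivative f (s + L)) (at s)" by simp
  then show "f (s + L) = f s"
    using assms(2) by (rule vector_derivative_unique_at)
qed

text \<open>A primitive of a function of mean zero is again periodic, and the constant of integration can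
  be chosen to make its mean zero as well, so the construction can be iterated. Having mean zero
  also yields the bound: each value of the primitive is the average of its differences to all
  other values.\<close>

lemma mean_zero_primitive:
  fixes h :: "real \<Rightarrow> 'a::euclidean_space"
  assumes L: "0 < L" and h: "continuous_on UNIV h" "periodic L h" "integral {0..L} h = 0"
    and B: "\<And>s. norm (h s) \<le> B"
  obtains H where "\<And>s. (H has_vector_derivative h s) (at s)" "periodic L H" "integral {0..L} H = 0"
    "\<And>s. norm (H s) \<le> L * B"
proof -
  have "\<exists>F. \<forall>x :: real. - \<infinity> < ereal x \<longrightarrow> ereal x < \<infinity> \<longrightarrow> (F has_vector_derivative h x) (at x)"
    by (rule einterval_antiderivative) (use h(1) in \<open>auto simp: continuous_on_eq_continuous_at\<close>)
  then obtain F where F: "\<And>s. (F has_vector_derivative h s) (at s)" by auto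
  have Fc: "continuous_on UNIV F"
    using F by (meson continuous_at_imp_continuous_on has_vector_derivative_continuous)
  have "((\<lambda>s. F (s + L) - F s) has_vector_derivative 0) (at s)" for s
  proof -
    have "(F \<circ> (\<lambda>s. s + L) has_vector_derivative 1 *\<^sub>R h (s + L)) (at s)"
      by (rule vector_diff_chain_at) (auto intro!: derivative_eq_intros F)
    then show ?thesis using has_vector_derivative_diff[OF _ F] h(2) by (fastforce simp: o_def periodic_def)
  qed
  then obtain c where c: "\<And>s. F (s + L) - F s = c"
    using has_vector_derivative_zero_constant[of UNIV "\<lambda>s. F (s + L) - F s"] by auto
  have "(h has_integral (F L - F 0)) {0..L}"
    using L F by (intro fundamental_theorem_of_calculus) (auto intro: has_vector_derivative_at_within)
  then have "c = 0" using c[of 0] h(3) by (simp add: integral_unique)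
  with c have Fp: "F (s + L) = F s" for s by (metis eq_iff_diff_eq_0)
  define H where "H = (\<lambda>s. F s - integral {0..L} F /\<^sub>R L)"
  have Hd: "(H has_vector_derivative h s) (at s)" for s
    unfolding H_def using has_vector_derivative_diff[OF F has_vector_derivative_const] by simp
  have Hp: "periodic L H" by (simp add: periodic_def H_def Fp)
  have Hc: "continuous_on {0..L} H" unfolding H_def by (intro continuous_intros continuous_on_subset[OF Fc]) auto
  have Hi: "integral {0..L} H = 0"
    unfolding H_def using L integrable_continuous_real[OF continuous_on_subset[OF Fc, of "{0..L}"]]
    by (subst integral_diff) auto
  have osc: "norm (H s - H \<sigma>) \<le> L * B" if "s \<in> {0..L}" "\<sigma> \<in> {0..L}" for s \<sigma>
  proof -
    have "norm (H s - H \<sigma>) \<le> B * norm (s - \<sigma>)"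
      by (rule differentiable_bound[of UNIV _ "\<lambda>s x. x *\<^sub>R h s"])
        (use Hd B in \<open>auto simp: has_vector_derivative_def onorm_scaleR_left bounded_linear_ident onorm_id\<close>)
    also have "\<dots> \<le> B * L"
      using that order_trans[OF norm_ge_zero B[of 0]] by (intro mult_left_mono) auto
    finally show ?thesis by (simp add: mult.commute)
  qed
  have bd: "norm (H s) \<le> L * B" if "s \<in> {0..L}" for s
  proof -
    have "L *\<^sub>R H s = integral {0..L} (\<lambda>\<sigma>. H s - H \<sigma>)"
      using integrable_continuous_real[OF Hc] Hi L by (subst integral_diff) auto
    moreover have "norm (integral {0..L} (\<lambda>\<sigma>. H s - H \<sigma>)) \<le> (L * B) * (L - 0)"
      by (rule integral_bound) (use L osc that Hc in \<open>auto intro!: continuous_intros\<close>)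
    ultimately have "L * norm (H s) \<le> L * (L * B)" using L by (metis abs_of_pos diff_zero mult.commute norm_scaleR)
    then show ?thesis using L by simp
  qed
  show ?thesis by (rule that[OF Hd Hp Hi]) (rule periodic_norm_le[OF L Hp bd])
qed

lemma smooth_periodicD:
  assumes "smooth_periodic L \<psi>"
  shows "((deriv ^^ k) \<psi> has_vector_derivative (deriv ^^ Suc k) \<psi> s) (at s)"
    and "periodic L ((deriv ^^ k) \<psi>)"
    and "continuous_on UNIV ((deriv ^^ k) \<psi>)"
proof -
  show *: "((deriv ^^ k) \<psi> has_vector_derivative (deriv ^^ Suc k) \<psi> s) (at s)" for k s
    using assms unfolding smooth_periodic_def
    by (metis DERIV_imp_deriv funpow.simps(2) has_real_derivative_iff_has_vector_derivative o_apply real_differentiable_def)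
  show "periodic L ((deriv ^^ k) \<psi>)"
  proof (induction k)
    case 0 then show ?case using assms by (simp add: smooth_periodic_def)
  next
    case (Suc k) then show ?case using periodic_derivative * by blast
  qed
  show "continuous_on UNIV ((deriv ^^ k) \<psi>)"
    using * by (meson continuous_at_imp_continuous_on has_vector_derivative_continuous)
qed

lemma smooth_periodic_const: "smooth_periodic L (\<lambda>_. c)"
proof -
  have "(deriv ^^ k) (\<lambda>_::real. c) = (\<lambda>_. if k = 0 then c else 0)" for k
    by (induction k) auto
  then show ?thesis by (auto simp: smooth_periodic_def periodic_def)
qed

text \<open>Every test function of mean zero is a derivative, of any order, of a test function. This
  turns the vanishing of a weak derivative of any order into orthogonality to all test functions
  of mean zero.\<close>

lemma smooth_periodic_iterated_primitive:
  assumes L: "0 < L" and \<phi>: "smooth_periodic L \<phi>" "integral {0..L} \<phi> = 0"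
  shows "\<exists>\<psi>. smooth_periodic L \<psi> \<and> integral {0..L} \<psi> = 0 \<and> (deriv ^^ k) \<psi> = \<phi>"
proof (induction k)
  case (Suc k)
  then obtain \<psi> where \<psi>: "smooth_periodic L \<psi>" "integral {0..L} \<psi> = 0" "(deriv ^^ k) \<psi> = \<phi>" by blast
  have c: "continuous_on UNIV \<psi>" and p: "periodic L \<psi>" using smooth_periodicD[OF \<psi>(1), of 0] by simp_all
  obtain B where "\<And>s. norm (\<psi> s) \<le> B" using periodic_bounded[OF L c p] by metis
  from mean_zero_primitive[OF L c p \<psi>(2) this] obtain H where
    H: "\<And>s. (H has_vector_derivative \<psi> s) (at s)" "periodic L H" "integral {0..L} H = 0" by metis
  have dH: "deriv H = \<psi>"
    using H(1) by (auto simp: has_real_derivative_iff_has_vector_derivative intro!: DERIV_imp_deriv)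
  have "(deriv ^^ j) H differentiable at s" for j s
  proof (cases j)
    case 0 then show ?thesis using H(1) by (auto intro: differentiableI_vector)
  next
    case (Suc i) then show ?thesis using \<psi>(1) dH by (simp add: smooth_periodic_def funpow_Suc_right del: funpow.simps)
  qed
  then have "smooth_periodic L H" using H(2) by (simp add: smooth_periodic_def)
  then show ?case using H(3) \<psi>(3) dH by (intro exI[of _ H]) (simp add: funpow_Suc_right del: funpow.simps)
qed (use \<phi> in auto)

section \<open>Weak derivatives of continuous functions\<close>

text \<open>Subtract the mean from \<open>h\<close>. The remainder \<open>h\<^sub>0\<close> is orthogonal to all test functions of mean zero,
  and it is a uniform limit of such functions by \<open>smooth_periodic_dense\<close>; so it is orthogonal to
  itself.\<close>

lemma weakly_constant_imp_constant_real:
  fixes h :: "real \<Rightarrow> real"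
  assumes L: "0 < L" and h: "continuous_on UNIV h" "periodic L h"
    and weak: "\<And>\<psi>. smooth_periodic L \<psi> \<Longrightarrow> integral {0..L} (\<lambda>s. (deriv ^^ k) \<psi> s * h s) = 0"
  shows "h s = integral {0..L} h / L"
proof -
  define h0 where "h0 = (\<lambda>s. h s - integral {0..L} h / L)"
  have h0: "continuous_on UNIV h0" "periodic L h0"
    using h by (auto simp: h0_def periodic_def intro!: continuous_intros)
  have int: "f integrable_on {0..L}" if "continuous_on UNIV f" for f :: "real \<Rightarrow> real"
    using that by (intro integrable_continuous_real) (auto intro: continuous_on_subset)
  have h0_mean: "integral {0..L} h0 = 0"
    unfolding h0_def using L int[OF h(1)] by (subst integral_diff) auto
  obtain B where B: "\<And>s. norm (h0 s) \<le> B" using periodic_bounded[OF L h0] by metis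
  have B0: "0 \<le> B" using order_trans[OF norm_ge_zero B[of 0]] .
  have small: "integral {0..L} (\<lambda>s. (h0 s)\<^sup>2) \<le> 2 * L * B * e" if e: "0 < e" for e
  proof -
    obtain \<rho> where \<rho>: "smooth_periodic L \<rho>" "\<And>s. \<bar>h0 s - \<rho> s\<bar> < e"
      using smooth_periodic_dense[OF L h0 e] by blast
    have \<rho>c: "continuous_on UNIV \<rho>" using smooth_periodicD(3)[OF \<rho>(1), of 0] by simp
    define m where "m = integral {0..L} \<rho> / L"
    have "\<bar>integral {0..L} (\<lambda>s. h0 s - \<rho> s)\<bar> \<le> e * (L - 0)"
      using L \<rho>(2) by (intro integral_bound[where 'a=real, simplified] continuous_intros continuous_on_subset[OF h0(1)] continuous_on_subset[OF \<rho>c])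
        (auto simp: less_imp_le)
    then have m: "\<bar>m\<bar> \<le> e"
      using L h0_mean int[OF h0(1)] int[OF \<rho>c] by (simp add: m_def integral_diff field_simps)
    \<comment> \<open>Since \<open>h0\<close> has mean zero, the approximation can be corrected to mean zero at the cost of another \<open>e\<close>.\<close>
    define \<phi> where "\<phi> = (\<lambda>s. \<rho> s - m)"
    have "(deriv ^^ j) \<phi> = (if j = 0 then \<phi> else (deriv ^^ j) \<rho>)" for j
    proof (induction j)
      case (Suc j)
      have "deriv \<phi> = deriv \<rho>"
        using smooth_periodicD(1)[OF \<rho>(1), of 0]
        by (intro ext DERIV_imp_deriv)
          (auto simp: \<phi>_def has_real_derivative_iff_has_vector_derivative intro!: derivative_eq_intros)
      with Suc show ?case by auto
    qed simp
    moreover have "\<phi> differentiable at s" for s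
      using \<rho>(1)[unfolded smooth_periodic_def, THEN conjunct2, rule_format, of 0 s] unfolding \<phi>_def by simp
    ultimately have \<phi>: "smooth_periodic L \<phi>"
      using \<rho>(1) by (auto simp: smooth_periodic_def periodic_def \<phi>_def)
    have \<phi>c: "continuous_on UNIV \<phi>" using smooth_periodicD(3)[OF \<phi>, of 0] by simp
    have \<phi>_mean: "integral {0..L} \<phi> = 0"
      unfolding \<phi>_def m_def using L int[OF \<rho>c] by (subst integral_diff) auto
    obtain \<psi> where \<psi>: "smooth_periodic L \<psi>" "(deriv ^^ k) \<psi> = \<phi>"
      using smooth_periodic_iterated_primitive[OF L \<phi> \<phi>_mean] by blast
    have "integral {0..L} (\<lambda>s. \<phi> s * h0 s)
        = integral {0..L} (\<lambda>s. \<phi> s * h s) - integral {0..L} (\<lambda>s. \<phi> s * (integral {0..L} h / L))"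
      unfolding h0_def right_diff_distrib
      by (intro integral_diff int continuous_intros \<phi>c h)
    also have "\<dots> = 0" using weak[OF \<psi>(1)] \<psi>(2) \<phi>_mean by simp
    finally have orth: "integral {0..L} (\<lambda>s. \<phi> s * h0 s) = 0" .
    have "integral {0..L} (\<lambda>s. (h0 s)\<^sup>2) = integral {0..L} (\<lambda>s. (h0 s - \<phi> s) * h0 s)"
      unfolding left_diff_distrib using orth
      by (subst integral_diff) (auto intro!: int continuous_intros \<phi>c h0 simp: power2_eq_square)
    also have "\<dots> \<le> integral {0..L} (\<lambda>s. 2 * e * B)"
    proof (rule integral_le)
      show "(h0 s - \<phi> s) * h0 s \<le> 2 * e * B" for s
      proof -
        have "\<bar>h0 s - \<phi> s\<bar> \<le> 2 * e" using \<rho>(2)[of s] m by (auto simp: \<phi>_def)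
        then have "\<bar>(h0 s - \<phi> s) * h0 s\<bar> \<le> (2 * e) * B"
          unfolding abs_mult using B[of s] e by (intro mult_mono) auto
        then show ?thesis by simp
      qed
    qed (auto intro!: int continuous_intros \<phi>c h0)
    also have "\<dots> = 2 * L * B * e" using L by simp
    finally show ?thesis .
  qed
  have "integral {0..L} (\<lambda>s. (h0 s)\<^sup>2) \<le> 0"
  proof (rule field_le_epsilon)
    fix e :: real assume "0 < e"
    then have "integral {0..L} (\<lambda>s. (h0 s)\<^sup>2) \<le> 2 * L * B * (e / (2 * L * B + 1))"
      using L B0 by (intro small) (auto intro!: divide_pos_pos add_nonneg_pos)
    also have "\<dots> \<le> e"
    proof -
      have "K * (e / (K + 1)) \<le> e" if "0 \<le> K" for K
        using that \<open>0 < e\<close> by (simp add: pos_divide_le_eq algebra_simps)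
      then show ?thesis using L B0 by simp
    qed
    finally show "integral {0..L} (\<lambda>s. (h0 s)\<^sup>2) \<le> 0 + e" by simp
  qed
  moreover have "integral {0..L} (\<lambda>s. (h0 s)\<^sup>2) \<ge> 0"
    by (intro integral_nonneg int continuous_intros h0) auto
  ultimately have "\<forall>s\<in>{0..L}. (h0 s)\<^sup>2 = 0"
    using L by (subst integral_eq_0_iff[symmetric]) (auto intro!: continuous_intros continuous_on_subset[OF h0(1)])
  then have zero: "h0 s = 0" if "s \<in> {0..L}" for s using that by simp
  have "h0 s = (\<lambda>_. 0) s"
    by (rule periodic_eqI[OF L h0(2)]) (use zero in \<open>auto simp: periodic_def\<close>)
  then show ?thesis by (simp add: h0_def)
qed

lemma weakly_constant_imp_constant:
  fixes h :: "real \<Rightarrow> 'a::euclidean_space"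
  assumes L: "0 < L" and h: "continuous_on UNIV h" "periodic L h"
    and weak: "\<And>\<psi>. smooth_periodic L \<psi> \<Longrightarrow> integral {0..L} (\<lambda>s. (deriv ^^ k) \<psi> s *\<^sub>R h s) = 0"
  shows "h s = integral {0..L} h /\<^sub>R L"
proof (rule euclidean_eqI)
  fix b :: 'a assume "b \<in> Basis"
  have hi: "h integrable_on {0..L}"
    using h by (intro integrable_continuous_real) (auto intro: continuous_on_subset)
  have "h s \<bullet> b = integral {0..L} (\<lambda>s. h s \<bullet> b) / L"
  proof (rule weakly_constant_imp_constant_real[OF L])
    fix \<psi> assume \<psi>: "smooth_periodic L \<psi>"
    have "(\<lambda>s. (deriv ^^ k) \<psi> s *\<^sub>R h s) integrable_on {0..L}"
      using smooth_periodicD(3)[OF \<psi>, of k] h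
      by (intro integrable_continuous_real) (auto intro!: continuous_intros intro: continuous_on_subset)
    from integral_component_eq[OF this, of b]
    show "integral {0..L} (\<lambda>s. (deriv ^^ k) \<psi> s * (h s \<bullet> b)) = 0" using weak[OF \<psi>] by simp
  qed (use h in \<open>auto intro!: continuous_intros simp: periodic_def\<close>)
  then show "h s \<bullet> b = (integral {0..L} h /\<^sub>R L) \<bullet> b"
    using hi by (simp add: divide_inverse)
qed

lemma L2_circle_norm_nonneg: "0 \<le> L2_circle_norm L f"
  by (simp add: L2_circle_norm_def)

text \<open>The sharp constant would be the square root of \<open>L\<close>. The cruder factor \<open>L + 1\<close> follows from the
  elementary inequality \<open>|g| \<le> \<eta> + |g|\<^sup>2 / \<eta>\<close> as \<open>\<eta>\<close> decreases to the \<open>L\<^sup>2\<close> norm of \<open>g\<close>.\<close>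

lemma L2_circle_imp_L1:
  fixes g :: "real \<Rightarrow> 'a::euclidean_space"
  assumes L: "0 < L" and g: "g \<in> L2_circle L"
  shows "integrable (lebesgue_on {0..L}) g"
    and "integral\<^sup>L (lebesgue_on {0..L}) (\<lambda>s. norm (g s)) \<le> (L + 1) * L2_circle_norm L g"
proof -
  let ?M = "lebesgue_on {0..L}"
  have m[measurable]: "g \<in> borel_measurable ?M" and i2: "integrable ?M (\<lambda>s. (norm (g s))\<^sup>2)"
    using g by (auto simp: L2_circle_def)
  have young: "norm (g s) \<le> \<eta> + (norm (g s))\<^sup>2 / \<eta>" if "0 < \<eta>" for s \<eta>
  proof -
    have "0 \<le> (norm (g s) - \<eta>)\<^sup>2 + norm (g s) * \<eta>" using that by simp
    then show ?thesis using that by (simp add: field_simps power2_eq_square)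
  qed
  have ib: "integrable ?M (\<lambda>s. \<eta> + (norm (g s))\<^sup>2 / \<eta>)" for \<eta>
    using i2 by (intro Bochner_Integration.integrable_add integrable_divide) auto
  show i: "integrable ?M g"
    by (rule Bochner_Integration.integrable_bound[OF ib[of 1]]) (use young[of 1] in auto)
  define N where "N = L2_circle_norm L g"
  have N2: "integral\<^sup>L ?M (\<lambda>s. (norm (g s))\<^sup>2) = N\<^sup>2"
    by (simp add: N_def L2_circle_norm_def)
  have N0: "0 \<le> N" by (simp add: N_def L2_circle_norm_nonneg)
  have bd: "integral\<^sup>L ?M (\<lambda>s. norm (g s)) \<le> (L + 1) * \<eta>" if "N < \<eta>" for \<eta>
  proof -
    have "0 < \<eta>" using that N0 by simp
    have "integral\<^sup>L ?M (\<lambda>s. norm (g s)) \<le> integral\<^sup>L ?M (\<lambda>s. \<eta> + (norm (g s))\<^sup>2 / \<eta>)"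
      using i young[OF \<open>0 < \<eta>\<close>] by (intro integral_mono ib) auto
    also have "\<dots> = \<eta> * L + N\<^sup>2 / \<eta>"
      using i2 L by (subst Bochner_Integration.integral_add) (auto simp: N2 measure_restrict_space)
    also have "N\<^sup>2 / \<eta> \<le> \<eta>" using that N0 by (simp add: pos_divide_le_eq power2_eq_square mult_mono)
    finally show ?thesis by (simp add: algebra_simps)
  qed
  show "integral\<^sup>L ?M (\<lambda>s. norm (g s)) \<le> (L + 1) * N"
  proof (rule field_le_epsilon)
    fix e :: real assume "0 < e"
    then have "integral\<^sup>L ?M (\<lambda>s. norm (g s)) \<le> (L + 1) * (N + e / (L + 1))"
      using L by (intro bd) auto
    also have "\<dots> = (L + 1) * N + e" using L by (simp add: field_simps)
    finally show "integral\<^sup>L ?M (\<lambda>s. norm (g s)) \<le> (L + 1) * N + e" .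
  qed
qed

text \<open>As \<open>g\<close> is merely integrable, its primitive need not be differentiable everywhere, and the product
  rule is not available. Instead \<open>\<psi>(L) - \<psi>(s)\<close> is written as the integral of \<open>\<psi>'\<close> over \<open>[s, L]\<close>, and the
  order of integration is exchanged over the triangle \<open>s \<le> \<sigma>\<close>. The end value \<open>\<psi>(L)\<close> does not
  contribute since \<open>g\<close> has mean zero.\<close>

lemma weak_integration_by_parts:
  fixes g :: "real \<Rightarrow> 'a::euclidean_space"
  assumes L: "0 < L" and g: "integrable (lebesgue_on {0..L}) g" "integral\<^sup>L (lebesgue_on {0..L}) g = 0"
    and \<psi>: "\<And>s. (\<psi> has_vector_derivative \<psi>' s) (at s)" "continuous_on UNIV \<psi>'"
  shows "integral\<^sup>L (lebesgue_on {0..L}) (\<lambda>s. \<psi> s *\<^sub>R g s) =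
     - integral {0..L} (\<lambda>s. \<psi>' s *\<^sub>R integral {0..s} g)"
proof -
  let ?M = "lebesgue_on {0..L}"
  interpret M: finite_measure ?M by (intro finite_measure_lebesgue_on) auto
  interpret P: pair_sigma_finite ?M ?M ..
  have [measurable]: "g \<in> borel_measurable ?M" using g(1) by auto
  have [measurable]: "(\<lambda>s. s) \<in> borel_measurable ?M" 
    by (intro measurable_restrict_space1 measurable_completion) auto
  have \<psi>'c: "continuous_on {0..L} \<psi>'" using \<psi>(2) continuous_on_subset by blast
  have [measurable]: "\<psi>' \<in> borel_measurable ?M"
    using continuous_imp_measurable_on_sets_lebesgue[OF \<psi>'c] by simp
  obtain C where C: "\<And>s. s \<in> {0..L} \<Longrightarrow> norm (\<psi>' s) \<le> C"
    using compact_imp_bounded[OF compact_continuous_image[OF \<psi>'c compact_Icc]] bounded_iff by (metis imageI)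
  define f where "f = (\<lambda>s \<sigma>. (if s \<le> \<sigma> then \<psi>' \<sigma> else 0) *\<^sub>R g s)"
  have f_meas: "case_prod f \<in> borel_measurable (?M \<Otimes>\<^sub>M ?M)" unfolding f_def by measurable
  have dom: "integrable (?M \<Otimes>\<^sub>M ?M) (\<lambda>(s, \<sigma>). C * norm (g s))"
    by (rule P.Fubini_integrable) (use g in \<open>auto simp: M.integrable_const\<close>)
  have f_int: "integrable (?M \<Otimes>\<^sub>M ?M) (case_prod f)"
  proof (rule Bochner_Integration.integrable_bound[OF dom f_meas], rule AE_I2)
    fix x assume "x \<in> space (?M \<Otimes>\<^sub>M ?M)"
    then have "snd x \<in> {0..L}" by (auto simp: space_pair_measure)
    then have "norm (\<psi>' (snd x)) * norm (g (fst x)) \<le> C * norm (g (fst x))" "0 \<le> C"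
      using C order_trans[OF norm_ge_zero C] by (auto intro: mult_right_mono)
    then show "norm (case_prod f x) \<le> norm (case x of (s, \<sigma>) \<Rightarrow> C * norm (g s))"
      by (auto simp: f_def split: prod.splits)
  qed
  have inner\<sigma>: "integral\<^sup>L ?M (\<lambda>\<sigma>. f s \<sigma>) = (\<psi> L - \<psi> s) *\<^sub>R g s" if s: "s \<in> {0..L}" for s
  proof -
    have ftc: "(\<psi>' has_integral (\<psi> L - \<psi> s)) {s..L}"
      using s \<psi>(1) by (intro fundamental_theorem_of_calculus) (auto intro: has_vector_derivative_at_within)
    have i: "integrable ?M (\<lambda>\<sigma>. if s \<le> \<sigma> then \<psi>' \<sigma> else 0)"
      by (rule Bochner_Integration.integrable_bound[OF continuous_imp_integrable_real[OF \<psi>'c]]) auto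
    have "integral\<^sup>L ?M (\<lambda>\<sigma>. if s \<le> \<sigma> then \<psi>' \<sigma> else 0) = integral {0..L} (\<lambda>\<sigma>. if \<sigma> \<in> {s..} then \<psi>' \<sigma> else 0)"
      using i by (subst lebesgue_integral_eq_integral) auto
    also have "\<dots> = integral ({s..} \<inter> {0..L}) \<psi>'" by (rule integral_restrict_Int)
    also have "{s..} \<inter> {0..L} = {s..L}" using s by auto
    also have "integral {s..L} \<psi>' = \<psi> L - \<psi> s" using ftc by (rule integral_unique)
    finally show ?thesis unfolding f_def using i by simp
  qed
  have inner_s: "integral\<^sup>L ?M (\<lambda>s. f s \<sigma>) = \<psi>' \<sigma> *\<^sub>R integral {0..\<sigma>} g" if \<sigma>: "\<sigma> \<in> {0..L}" for \<sigma>
  proof -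
    have i: "integrable ?M (\<lambda>s. if s \<le> \<sigma> then g s else 0)"
      by (rule Bochner_Integration.integrable_bound[OF g(1)]) auto
    have "integral\<^sup>L ?M (\<lambda>s. if s \<le> \<sigma> then g s else 0) = integral {0..L} (\<lambda>s. if s \<in> {..\<sigma>} then g s else 0)"
      using i by (subst lebesgue_integral_eq_integral) auto
    also have "\<dots> = integral ({..\<sigma>} \<inter> {0..L}) g" by (rule integral_restrict_Int)
    also have "{..\<sigma>} \<inter> {0..L} = {0..\<sigma>}" using \<sigma> by auto
    finally have "integral\<^sup>L ?M (\<lambda>s. if s \<le> \<sigma> then g s else 0) = integral {0..\<sigma>} g" .
    moreover have "(\<lambda>s. f s \<sigma>) = (\<lambda>s. \<psi>' \<sigma> *\<^sub>R (if s \<le> \<sigma> then g s else 0))" by (auto simp: f_def)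
    ultimately show ?thesis by simp
  qed
  have \<psi>c: "continuous_on {0..L} \<psi>"
    using \<psi>(1) by (meson continuous_at_imp_continuous_on has_vector_derivative_continuous)
  have [measurable]: "\<psi> \<in> borel_measurable ?M"
    using continuous_imp_measurable_on_sets_lebesgue[OF \<psi>c] by simp
  obtain D where D: "\<And>s. s \<in> {0..L} \<Longrightarrow> norm (\<psi> s) \<le> D"
    using compact_imp_bounded[OF compact_continuous_image[OF \<psi>c compact_Icc]] bounded_iff by (metis imageI)
  have \<psi>g: "integrable ?M (\<lambda>s. \<psi> s *\<^sub>R g s)"
  proof (rule Bochner_Integration.integrable_bound)
    show "integrable ?M (\<lambda>s. D * norm (g s))" using g by simp
    show "AE s in ?M. norm (\<psi> s *\<^sub>R g s) \<le> norm (D * norm (g s))"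
    proof (rule AE_I2)
      fix s assume "s \<in> space ?M"
      then have "\<bar>\<psi> s\<bar> \<le> \<bar>D\<bar>" using order_trans[OF D abs_ge_self] by simp
      then show "norm (\<psi> s *\<^sub>R g s) \<le> norm (D * norm (g s))" by (simp add: abs_mult mult_right_mono)
    qed
  qed simp
  have "continuous_on {0..L} (\<lambda>\<sigma>. \<psi>' \<sigma> *\<^sub>R integral {0..\<sigma>} g)"
    using g(1) by (intro continuous_intros \<psi>'c indefinite_integral_continuous_1 integrable_on_lebesgue_on) auto
  then have "integral {0..L} (\<lambda>\<sigma>. \<psi>' \<sigma> *\<^sub>R integral {0..\<sigma>} g) = integral\<^sup>L ?M (\<lambda>\<sigma>. \<psi>' \<sigma> *\<^sub>R integral {0..\<sigma>} g)"
    by (subst lebesgue_integral_eq_integral) (auto intro: continuous_imp_integrable_real)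
  also have "\<dots> = (\<integral>\<sigma>. (\<integral>s. f s \<sigma> \<partial>?M) \<partial>?M)" by (rule Bochner_Integration.integral_cong) (auto simp: inner_s)
  also have "\<dots> = (\<integral>s. (\<integral>\<sigma>. f s \<sigma> \<partial>?M) \<partial>?M)" using f_int by (rule P.Fubini_integral)
  also have "\<dots> = integral\<^sup>L ?M (\<lambda>s. \<psi> L *\<^sub>R g s - \<psi> s *\<^sub>R g s)"
    by (rule Bochner_Integration.integral_cong) (auto simp: inner\<sigma> scaleR_left_diff_distrib)
  also have "\<dots> = - integral\<^sup>L ?M (\<lambda>s. \<psi> s *\<^sub>R g s)"
    using g \<psi>g by (subst Bochner_Integration.integral_diff) auto
  finally show ?thesis by simp
qed

text \<open>The counterpart of \<open>mean_zero_primitive\<close> for an integrable function: the primitive is still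
  continuous, and it is a primitive in the weak sense.\<close>

lemma weak_primitive:
  fixes g :: "real \<Rightarrow> 'a::euclidean_space"
  assumes L: "0 < L" and g: "integrable (lebesgue_on {0..L}) g" "integral\<^sup>L (lebesgue_on {0..L}) g = 0"
  obtains H where "continuous_on UNIV H" "periodic L H" "integral {0..L} H = 0"
    "\<And>s. norm (H s) \<le> 2 * integral\<^sup>L (lebesgue_on {0..L}) (\<lambda>s. norm (g s))"
    "\<And>\<psi>. smooth_periodic L \<psi> \<Longrightarrow>
       integral\<^sup>L (lebesgue_on {0..L}) (\<lambda>s. \<psi> s *\<^sub>R g s) = - integral {0..L} (\<lambda>s. deriv \<psi> s *\<^sub>R H s)"
proof -
  let ?M = "lebesgue_on {0..L}"
  define N where "N = integral\<^sup>L ?M (\<lambda>s. norm (g s))"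
  have gi: "g integrable_on {0..L}" "(\<lambda>s. norm (g s)) integrable_on {0..L}"
    using g(1) by (auto intro!: integrable_on_lebesgue_on)
  have N: "N = integral {0..L} (\<lambda>s. norm (g s))"
    unfolding N_def using g(1) by (intro lebesgue_integral_eq_integral) auto
  define G where "G = (\<lambda>s. integral {0..s} g)"
  have Gc: "continuous_on {0..L} G" unfolding G_def by (rule indefinite_integral_continuous_1[OF gi(1)])
  have G: "norm (G s) \<le> N" if "s \<in> {0..L}" for s
  proof -
    have "norm (G s) \<le> integral {0..s} (\<lambda>s. norm (g s))"
      unfolding G_def using that gi
      by (intro integral_norm_bound_integral integrable_on_subinterval[OF gi(1)] integrable_on_subinterval[OF gi(2)]) auto
    also have "\<dots> \<le> N"
      unfolding N using that by (intro integral_subset_le integrable_on_subinterval[OF gi(2)] gi) auto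
    finally show ?thesis .
  qed
  define m where "m = integral {0..L} G /\<^sub>R L"
  have "norm (integral {0..L} G) \<le> N * (L - 0)"
    using L G by (intro integral_bound Gc) auto
  then have m: "norm m \<le> N" using L by (simp add: m_def field_simps)
  have "continuous_on {0..L} (\<lambda>s. G s - m)" "G 0 - m = G L - m"
    using Gc g lebesgue_integral_eq_integral[OF g(1)] by (auto simp: G_def intro!: continuous_intros)
  from periodic_extension[OF L this] obtain H where
    H: "continuous_on UNIV H" "periodic L H" "\<And>s. s \<in> {0..L} \<Longrightarrow> H s = G s - m"
    by blast
  show ?thesis
  proof
    show "continuous_on UNIV H" "periodic L H" by fact+
    have "integral {0..L} H = integral {0..L} (\<lambda>s. G s - m)" by (rule integral_cong) (rule H(3))
    also have "\<dots> = 0" using L integrable_continuous_real[OF Gc] by (subst integral_diff) (auto simp: m_def)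
    finally show "integral {0..L} H = 0" .
    have bd: "norm (H s) \<le> 2 * N" if "s \<in> {0..L}" for s
      using norm_triangle_ineq4[of "G s" m] G[OF that] m H(3)[OF that] by simp
    show "norm (H s) \<le> 2 * integral\<^sup>L ?M (\<lambda>s. norm (g s))" for s
      using periodic_norm_le[OF L H(2) bd] by (simp flip: N_def)
    fix \<psi> assume \<psi>: "smooth_periodic L \<psi>"
    have d: "(\<psi> has_vector_derivative deriv \<psi> s) (at s)" for s using smooth_periodicD(1)[OF \<psi>, of 0] by simp
    have dc: "continuous_on UNIV (deriv \<psi>)" using smooth_periodicD(3)[OF \<psi>, of 1] by simp
    have dc': "continuous_on {0..L} (deriv \<psi>)" using dc continuous_on_subset by blast
    have "integral {0..L} (\<lambda>s. deriv \<psi> s *\<^sub>R H s) = integral {0..L} (\<lambda>s. deriv \<psi> s *\<^sub>R G s - deriv \<psi> s *\<^sub>R m)"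
      by (rule integral_cong) (simp add: H(3) scaleR_diff_right)
    also have "\<dots> = integral {0..L} (\<lambda>s. deriv \<psi> s *\<^sub>R G s) - integral {0..L} (deriv \<psi>) *\<^sub>R m"
      using integrable_continuous_real[OF dc']
        integral_linear[OF _ bounded_linear_scaleR_left, of "deriv \<psi>" "{0..L}" m]
      by (subst integral_diff) (auto intro!: integrable_continuous_real continuous_intros dc' Gc simp: o_def)
    also have "integral {0..L} (deriv \<psi>) = 0"
      using integral_periodic_derivative[OF L _ d] smooth_periodicD(2)[OF \<psi>, of 0] by (simp add: integral_unique)
    finally show "integral\<^sup>L ?M (\<lambda>s. \<psi> s *\<^sub>R g s) = - integral {0..L} (\<lambda>s. deriv \<psi> s *\<^sub>R H s)"
      using weak_integration_by_parts[OF L g d dc] by (simp add: G_def)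
  qed
qed

text \<open>Four successive primitives \<open>H1, \<dots>, H4\<close> of mean zero are taken, starting from the weak derivative
  \<open>g\<close>. The last one has the same fourth weak derivative as \<open>f\<close>, so \<open>f - H4\<close> is constant, and
  \<open>H3, H2, H1\<close> are the classical derivatives of \<open>f\<close>. Each primitive costs a factor \<open>L\<close> in the bounds.
  Only \<open>f\<close> itself is not controlled by \<open>g\<close>; its mean is missing.\<close>

lemma weak_fourth_derivative_imp_C3:
  fixes f :: "real \<Rightarrow> 'a::euclidean_space"
  assumes L: "0 < L" and f: "continuous_on UNIV f" "periodic L f" and g: "is_weak_deriv L 4 f g"
  obtains f1 f2 f3 where
    "\<And>s. (f has_vector_derivative f1 s) (at s)"
    "\<And>s. (f1 has_vector_derivative f2 s) (at s)"
    "\<And>s. (f2 has_vector_derivative f3 s) (at s)"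
    "continuous_on UNIV f3"
    "\<And>s. norm (f3 s) \<le> 2 * (L + 1) * L2_circle_norm L g"
    "\<And>s. norm (f2 s) \<le> 2 * (L + 1) * L * L2_circle_norm L g"
    "\<And>s. norm (f1 s) \<le> 2 * (L + 1) * L\<^sup>2 * L2_circle_norm L g"
    "\<And>s. norm (f s - integral {0..L} f /\<^sub>R L) \<le> 2 * (L + 1) * L ^ 3 * L2_circle_norm L g"
proof -
  let ?M = "lebesgue_on {0..L}"
  let ?N = "L2_circle_norm L g"
  have gL2: "g \<in> L2_circle L" using g by (simp add: is_weak_deriv_def)
  have weak: "integral\<^sup>L ?M (\<lambda>s. (deriv ^^ 4) \<psi> s *\<^sub>R f s) = integral\<^sup>L ?M (\<lambda>s. \<psi> s *\<^sub>R g s)"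
    if "smooth_periodic L \<psi>" for \<psi>
    using g that by (simp add: is_weak_deriv_def)
  note gi = L2_circle_imp_L1(1)[OF L gL2]
  have "(deriv ^^ 4) (\<lambda>_::real. 1::real) = (\<lambda>_. 0)" by (simp add: numeral_eq_Suc)
  then have g0: "integral\<^sup>L ?M g = 0"
    using weak[OF smooth_periodic_const[of L 1]] by simp
  obtain H1 where H1: "continuous_on UNIV H1" "periodic L H1" "integral {0..L} H1 = 0"
    "\<And>s. norm (H1 s) \<le> 2 * integral\<^sup>L ?M (\<lambda>s. norm (g s))"
    "\<And>\<psi>. smooth_periodic L \<psi> \<Longrightarrow>
       integral\<^sup>L ?M (\<lambda>s. \<psi> s *\<^sub>R g s) = - integral {0..L} (\<lambda>s. deriv \<psi> s *\<^sub>R H1 s)"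
    by (rule weak_primitive[OF L gi g0]) (rule that)
  have B1: "norm (H1 s) \<le> 2 * (L + 1) * ?N" for s
    using H1(4)[of s] L2_circle_imp_L1(2)[OF L gL2] by (simp add: algebra_simps)
  obtain H2 where H2: "\<And>s. (H2 has_vector_derivative H1 s) (at s)" "periodic L H2" "integral {0..L} H2 = 0"
    and B2: "\<And>s. norm (H2 s) \<le> L * (2 * (L + 1) * ?N)"
    by (rule mean_zero_primitive[OF L H1(1-3) B1]) (rule that)
  have c2: "continuous_on UNIV H2"
    using H2(1) by (meson continuous_at_imp_continuous_on has_vector_derivative_continuous)
  obtain H3 where H3: "\<And>s. (H3 has_vector_derivative H2 s) (at s)" "periodic L H3" "integral {0..L} H3 = 0"
    and B3: "\<And>s. norm (H3 s) \<le> L * (L * (2 * (L + 1) * ?N))"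
    by (rule mean_zero_primitive[OF L c2 H2(2,3) B2]) (rule that)
  have c3: "continuous_on UNIV H3"
    using H3(1) by (meson continuous_at_imp_continuous_on has_vector_derivative_continuous)
  obtain H4 where H4: "\<And>s. (H4 has_vector_derivative H3 s) (at s)" "periodic L H4" "integral {0..L} H4 = 0"
    and B4: "\<And>s. norm (H4 s) \<le> L * (L * (L * (2 * (L + 1) * ?N)))"
    by (rule mean_zero_primitive[OF L c3 H3(2,3) B3]) (rule that)
  have c4: "continuous_on UNIV H4"
    using H4(1) by (meson continuous_at_imp_continuous_on has_vector_derivative_continuous)
  have "f s - H4 s = integral {0..L} (\<lambda>s. f s - H4 s) /\<^sub>R L" for s
  proof (rule weakly_constant_imp_constant[OF L, where k = 4])
    fix \<psi> assume \<psi>: "smooth_periodic L \<psi>"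
    have int: "(\<lambda>s. (deriv ^^ 4) \<psi> s *\<^sub>R h s) integrable_on {0..L}" if "continuous_on UNIV h" for h :: "real \<Rightarrow> 'a"
      by (rule integrable_continuous_real, rule continuous_on_subset[of UNIV])
        (intro continuous_intros smooth_periodicD(3)[OF \<psi>] that, simp)
    have parts: "integral {0..L} (\<lambda>s. (deriv ^^ k) \<psi> s *\<^sub>R h s) = - integral {0..L} (\<lambda>s. (deriv ^^ Suc k) \<psi> s *\<^sub>R H s)"
      if "continuous_on UNIV h" "periodic L H" "\<And>s. (H has_vector_derivative h s) (at s)" for k h and H :: "real \<Rightarrow> 'a"
      by (rule periodic_integration_by_parts[OF L bounded_bilinear_scaleR])
        (intro smooth_periodicD[OF \<psi>] that)+
    have "integral {0..L} (\<lambda>s. (deriv ^^ 4) \<psi> s *\<^sub>R H4 s) = integral\<^sup>L ?M (\<lambda>s. \<psi> s *\<^sub>R g s)"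
      using H1(5)[OF \<psi>] parts[OF H1(1) H2(2,1), of 1] parts[OF c2 H3(2,1), of 2] parts[OF c3 H4(2,1), of 3]
      by (simp add: numeral_eq_Suc)
    also have "\<dots> = integral\<^sup>L ?M (\<lambda>s. (deriv ^^ 4) \<psi> s *\<^sub>R f s)" using weak[OF \<psi>] by simp
    also have "\<dots> = integral {0..L} (\<lambda>s. (deriv ^^ 4) \<psi> s *\<^sub>R f s)"
    proof (rule lebesgue_integral_eq_integral)
      show "integrable ?M (\<lambda>s. (deriv ^^ 4) \<psi> s *\<^sub>R f s)"
        by (rule continuous_imp_integrable_real, rule continuous_on_subset[of UNIV])
          (intro continuous_intros smooth_periodicD(3)[OF \<psi>] f, simp)
    qed simp
    finally show "integral {0..L} (\<lambda>s. (deriv ^^ 4) \<psi> s *\<^sub>R (f s - H4 s)) = 0"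
      unfolding scaleR_diff_right using int[OF f(1)] int[OF c4] by (subst integral_diff) auto
  qed (use f c4 H4(2) in \<open>auto simp: periodic_def intro!: continuous_intros\<close>)
  moreover have "integral {0..L} (\<lambda>s. f s - H4 s) = integral {0..L} f"
    using H4(3) f c4 by (subst integral_diff) (auto intro!: integrable_continuous_real intro: continuous_on_subset)
  ultimately have f_eq: "f s - integral {0..L} f /\<^sub>R L = H4 s" for s by (simp add: algebra_simps)
  have "(\<lambda>s. H4 s + integral {0..L} f /\<^sub>R L) = f"
    using f_eq by (auto simp: fun_eq_iff algebra_simps)
  then have "(f has_vector_derivative H3 s) (at s)" for s
    using has_vector_derivative_add[OF H4(1)[of s] has_vector_derivative_const[of "integral {0..L} f /\<^sub>R L"]] by simp
  from that[OF this H3(1) H2(1) H1(1) B1] show ?thesis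
    using B2 B3 B4 f_eq by (simp add: power2_eq_square power3_eq_cube algebra_simps)
qed

text \<open>The witness is the weak derivative that was chosen in the definition of the norm, for which the
  inequality is immediate.\<close>

lemma Sobolev_weak_derivative:
  assumes "f \<in> Sobolev L m" "k \<le> m"
  obtains g where "is_weak_deriv L k f g" "L2_circle_norm L g \<le> Sobolev_norm L m f"
proof
  let ?g = "\<lambda>k. SOME g. is_weak_deriv L k f g"
  have "\<exists>g. is_weak_deriv L k f g" using assms by (simp add: Sobolev_def)
  then show "is_weak_deriv L k f (?g k)" by (rule someI_ex)
  have "(L2_circle_norm L (?g k))\<^sup>2 \<le> (\<Sum>k\<le>m. (L2_circle_norm L (?g k))\<^sup>2)"
    using assms(2) by (intro member_le_sum) auto
  then show "L2_circle_norm L (?g k) \<le> Sobolev_norm L m f"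
    unfolding Sobolev_norm_def by (rule real_le_rsqrt)
qed

section \<open>Continuous curves in the fourth Sobolev space\<close>

text \<open>The first summand adds up the bounds of \<open>weak_fourth_derivative_imp_C3\<close>, the second one
  bounds the mean.\<close>

definition Sobolev_const :: "real \<Rightarrow> real" where
  "Sobolev_const L = 2 * (L + 1) * (1 + L + L\<^sup>2 + L ^ 3) + (L + 1) / L"

text \<open>The mean of \<open>f\<close> is the mean of any weak derivative of order zero, tested against the constant
  function, and is therefore bounded by the Sobolev norm as well.\<close>

lemma Sobolev_embedding:
  fixes f :: "real \<Rightarrow> 'a::euclidean_space"
  assumes L: "0 < L" and f: "continuous_on UNIV f" "f \<in> Sobolev L 4"
  obtains f1 f2 f3 where
    "\<And>s. (f has_vector_derivative f1 s) (at s)"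
    "\<And>s. (f1 has_vector_derivative f2 s) (at s)"
    "\<And>s. (f2 has_vector_derivative f3 s) (at s)"
    "continuous_on UNIV f3"
    "\<And>s h. h \<in> {f, f1, f2, f3} \<Longrightarrow> norm (h s) \<le> Sobolev_const L * Sobolev_norm L 4 f"
proof -
  let ?M = "lebesgue_on {0..L}"
  let ?N = "Sobolev_norm L 4 f"
  have p: "periodic L f" using f by (simp add: Sobolev_def L2_circle_def)
  obtain g where g: "is_weak_deriv L 4 f g" "L2_circle_norm L g \<le> ?N"
    using Sobolev_weak_derivative[OF f(2), of 4] by auto
  obtain g0 where g0: "is_weak_deriv L 0 f g0" "L2_circle_norm L g0 \<le> ?N"
    using Sobolev_weak_derivative[OF f(2), of 0] by auto
  have g0L2: "g0 \<in> L2_circle L" using g0 by (simp add: is_weak_deriv_def)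
  have N0: "0 \<le> ?N" using g(2) L2_circle_norm_nonneg[of L g] by simp
  have "integral {0..L} f = integral\<^sup>L ?M f"
    using f(1) by (subst lebesgue_integral_eq_integral) (auto intro!: continuous_imp_integrable_real intro: continuous_on_subset)
  also have "\<dots> = integral\<^sup>L ?M g0"
    using g0(1) smooth_periodic_const[of L 1] by (force simp: is_weak_deriv_def)
  also have "norm \<dots> \<le> integral\<^sup>L ?M (\<lambda>s. norm (g0 s))" by (rule integral_norm_bound)
  also have "\<dots> \<le> (L + 1) * L2_circle_norm L g0" by (rule L2_circle_imp_L1(2)[OF L g0L2])
  also have "\<dots> \<le> (L + 1) * ?N" using g0(2) L by (intro mult_left_mono) auto
  finally have "norm (integral {0..L} f) \<le> (L + 1) * ?N" .
  then have mean: "norm (integral {0..L} f /\<^sub>R L) \<le> (L + 1) / L * ?N"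
    using L by (simp add: field_simps)
  obtain f1 f2 f3 where d: "\<And>s. (f has_vector_derivative f1 s) (at s)"
    "\<And>s. (f1 has_vector_derivative f2 s) (at s)" "\<And>s. (f2 has_vector_derivative f3 s) (at s)"
    "continuous_on UNIV f3"
    and bd: "\<And>s. norm (f3 s) \<le> 2 * (L + 1) * L2_circle_norm L g"
    "\<And>s. norm (f2 s) \<le> 2 * (L + 1) * L * L2_circle_norm L g"
    "\<And>s. norm (f1 s) \<le> 2 * (L + 1) * L\<^sup>2 * L2_circle_norm L g"
    "\<And>s. norm (f s - integral {0..L} f /\<^sub>R L) \<le> 2 * (L + 1) * L ^ 3 * L2_circle_norm L g"
    by (rule weak_fourth_derivative_imp_C3[OF L f(1) p g(1)]) (rule that)
  have step: "2 * (L + 1) * q * L2_circle_norm L g \<le> 2 * (L + 1) * q * ?N" if "0 \<le> q" for q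
    using L g(2) that by (intro mult_left_mono) auto
  have bd': "norm (h s) \<le> Sobolev_const L * ?N" if "h \<in> {f, f1, f2, f3}" for s h
  proof -
    have K: "Sobolev_const L * ?N = 2 * (L + 1) * 1 * ?N + 2 * (L + 1) * L * ?N
        + 2 * (L + 1) * L\<^sup>2 * ?N + 2 * (L + 1) * L ^ 3 * ?N + (L + 1) / L * ?N"
      by (simp add: Sobolev_const_def algebra_simps)
    have nn: "0 \<le> 2 * (L + 1) * 1 * ?N" "0 \<le> 2 * (L + 1) * L * ?N" "0 \<le> 2 * (L + 1) * L\<^sup>2 * ?N"
      "0 \<le> 2 * (L + 1) * L ^ 3 * ?N" "0 \<le> (L + 1) / L * ?N"
      using L N0 by simp_all
    have "norm (f s) \<le> norm (f s - integral {0..L} f /\<^sub>R L) + norm (integral {0..L} f /\<^sub>R L)"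
      using norm_triangle_sub[of "f s" "integral {0..L} f /\<^sub>R L"] by simp
    moreover have "0 \<le> L" "0 \<le> L\<^sup>2" "0 \<le> L ^ 3" using L by simp_all
    note steps = step[of 1, simplified mult_1_right] step[OF this(1)] step[OF this(2)] step[OF this(3)]
    ultimately have "norm (f s) \<le> Sobolev_const L * ?N" "norm (f1 s) \<le> Sobolev_const L * ?N"
      "norm (f2 s) \<le> Sobolev_const L * ?N" "norm (f3 s) \<le> Sobolev_const L * ?N"
      unfolding K using bd[of s] mean nn steps by linarith+
    then show ?thesis using that by auto
  qed
  show ?thesis by (rule that[of f1 f2 f3]) (fact d bd')+
qed

lemma L2_circle_smooth_mult_integrable:
  fixes g :: "real \<Rightarrow> 'a::euclidean_space"
  assumes L: "0 < L" and g: "g \<in> L2_circle L" and h: "continuous_on UNIV h" "periodic L h"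
  shows "integrable (lebesgue_on {0..L}) (\<lambda>s. h s *\<^sub>R g s)"
proof -
  let ?M = "lebesgue_on {0..L}"
  obtain B where B: "\<And>s. norm (h s) \<le> B" using periodic_bounded[OF L h] by metis
  have [measurable]: "g \<in> borel_measurable ?M" using g by (simp add: L2_circle_def)
  have [measurable]: "h \<in> borel_measurable ?M"
    using continuous_imp_measurable_on_sets_lebesgue[of "{0..L}" h] h(1) continuous_on_subset by auto
  show ?thesis
  proof (rule Bochner_Integration.integrable_bound)
    show "integrable ?M (\<lambda>s. B * norm (g s))" using L2_circle_imp_L1(1)[OF L g] by simp
    show "AE s in ?M. norm (h s *\<^sub>R g s) \<le> norm (B * norm (g s))"
    proof (rule AE_I2)
      fix s
      have "\<bar>h s\<bar> \<le> \<bar>B\<bar>" using order_trans[OF B abs_ge_self] by simp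
      then show "norm (h s *\<^sub>R g s) \<le> norm (B * norm (g s))" by (simp add: abs_mult mult_right_mono)
    qed
  qed simp
qed

lemma L2_circle_diff:
  fixes f g :: "real \<Rightarrow> 'a::euclidean_space"
  assumes "f \<in> L2_circle L" "g \<in> L2_circle L"
  shows "(\<lambda>s. f s - g s) \<in> L2_circle L"
proof -
  let ?M = "lebesgue_on {0..L}"
  have [measurable]: "f \<in> borel_measurable ?M" "g \<in> borel_measurable ?M"
    using assms by (auto simp: L2_circle_def)
  have "integrable ?M (\<lambda>s. (norm (f s - g s))\<^sup>2)"
  proof (rule Bochner_Integration.integrable_bound)
    show "integrable ?M (\<lambda>s. 2 * (norm (f s))\<^sup>2 + 2 * (norm (g s))\<^sup>2)"
      using assms by (simp add: L2_circle_def)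
    show "AE s in ?M. norm ((norm (f s - g s))\<^sup>2) \<le> norm (2 * (norm (f s))\<^sup>2 + 2 * (norm (g s))\<^sup>2)"
    proof (rule AE_I2)
      fix s
      have "(norm (f s - g s))\<^sup>2 \<le> (norm (f s) + norm (g s))\<^sup>2"
        by (intro power_mono norm_triangle_ineq4) auto
      also have "\<dots> \<le> 2 * (norm (f s))\<^sup>2 + 2 * (norm (g s))\<^sup>2"
        using zero_le_power2[of "norm (f s) - norm (g s)"] by (simp add: power2_eq_square algebra_simps)
      finally show "norm ((norm (f s - g s))\<^sup>2) \<le> norm (2 * (norm (f s))\<^sup>2 + 2 * (norm (g s))\<^sup>2)" by simp
    qed
  qed simp
  then show ?thesis using assms by (auto simp: L2_circle_def periodic_def)
qed

lemma Sobolev_diff: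
  fixes f g :: "real \<Rightarrow> 'a::euclidean_space"
  assumes L: "0 < L" and f: "f \<in> Sobolev L m" and g: "g \<in> Sobolev L m"
  shows "(\<lambda>s. f s - g s) \<in> Sobolev L m"
proof -
  have L2: "f \<in> L2_circle L" "g \<in> L2_circle L" using f g by (auto simp: Sobolev_def)
  have "\<exists>h. is_weak_deriv L k (\<lambda>s. f s - g s) h" if k: "k \<le> m" for k
  proof -
    obtain f' g' where w: "is_weak_deriv L k f f'" "is_weak_deriv L k g g'"
      using Sobolev_weak_derivative[OF f k] Sobolev_weak_derivative[OF g k] by meson
    then have L2': "f' \<in> L2_circle L" "g' \<in> L2_circle L" by (auto simp: is_weak_deriv_def)
    have "is_weak_deriv L k (\<lambda>s. f s - g s) (\<lambda>s. f' s - g' s)"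
      unfolding is_weak_deriv_def scaleR_diff_right
    proof (intro conjI allI impI L2_circle_diff L2')
      fix \<psi> assume \<psi>: "smooth_periodic L \<psi>"
      have i: "integrable (lebesgue_on {0..L}) (\<lambda>s. (deriv ^^ j) \<psi> s *\<^sub>R h s)" if "h \<in> L2_circle L" for h :: "real \<Rightarrow> 'a" and j
        by (rule L2_circle_smooth_mult_integrable[OF L that smooth_periodicD(3,2)[OF \<psi>]])
      show "integral\<^sup>L (lebesgue_on {0..L}) (\<lambda>s. (deriv ^^ k) \<psi> s *\<^sub>R f s - (deriv ^^ k) \<psi> s *\<^sub>R g s) =
        (-1) ^ k *\<^sub>R integral\<^sup>L (lebesgue_on {0..L}) (\<lambda>s. \<psi> s *\<^sub>R f' s - \<psi> s *\<^sub>R g' s)"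
        using w \<psi> i[OF L2(1), of k] i[OF L2(2), of k] i[OF L2'(1), of 0] i[OF L2'(2), of 0]
        by (simp add: is_weak_deriv_def scaleR_diff_right)
    qed
    then show ?thesis by blast
  qed
  with L2_circle_diff[OF L2] show ?thesis by (simp add: Sobolev_def)
qed

abbreviation half_plane :: "(real * real) set" where
  "half_plane \<equiv> SIGMA s:UNIV. {0..}"

lemma continuous_on_half_plane:
  fixes y :: "real \<Rightarrow> real \<Rightarrow> 'a::real_normed_vector"
  assumes s: "\<And>t. t \<ge> 0 \<Longrightarrow> continuous_on UNIV (\<lambda>s. y s t)"
    and t: "\<And>s t \<tau>. 0 \<le> t \<Longrightarrow> 0 \<le> \<tau> \<Longrightarrow> norm (y s \<tau> - y s t) \<le> N \<tau> t"
    and N: "\<And>t. 0 \<le> t \<Longrightarrow> ((\<lambda>\<tau>. N \<tau> t) \<longlongrightarrow> 0) (at t within {0..})"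
  shows "continuous_on half_plane (\<lambda>(s, t). y s t)"
  unfolding continuous_on_def
proof (clarsimp, goal_cases)
  case (1 s t)
  let ?F = "at (s, t) within half_plane"
  have in_dom: "eventually (\<lambda>p. snd p \<in> {0..}) ?F" 
    unfolding eventually_at_filter by (rule always_eventually) auto
  have "filterlim snd (nhds t) ?F" by (auto intro!: tendsto_eq_intros)
  then have snd: "filterlim snd (at t within {0..}) (inf ?F (principal {p. snd p \<noteq> t}))"
    using in_dom by (auto simp: filterlim_at eventually_inf_principal intro: filterlim_mono[OF _ order_refl inf_le1] elim: eventually_mono)
  \<comment> \<open>Points at the same time \<open>t\<close> are treated apart: the limit of \<open>N \<tau> t\<close> only concerns \<open>\<tau> \<noteq> t\<close>.\<close>
  have N': "((\<lambda>p. if snd p = t then 0 else N (snd p) t) \<longlongrightarrow> 0) ?F"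
    by (rule filterlim_If) (use filterlim_compose[OF N[OF 1] snd] in \<open>auto simp: o_def\<close>)
  have "((\<lambda>p. y (fst p) (snd p) - y (fst p) t) \<longlongrightarrow> 0) ?F"
    by (rule Lim_null_comparison[OF _ N']) (use t 1 in_dom in \<open>auto elim!: eventually_mono\<close>)
  moreover have "((\<lambda>p. y (fst p) t) \<longlongrightarrow> y s t) ?F"
    using s[OF 1] by (intro isCont_tendsto_compose[where g = "\<lambda>s. y s t"]) 
      (auto simp: continuous_on_eq_continuous_at intro!: tendsto_eq_intros)
  ultimately show ?case
    using tendsto_add[of _ 0 ?F "\<lambda>p. y (fst p) t" "y s t"] by (fastforce simp: case_prod_unfold)
qed

text \<open>The embedding is applied twice: to each function \<open>x(\<cdot>, t)\<close>, which yields the derivatives, and to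
  the differences \<open>x(\<cdot>, \<tau>) - x(\<cdot>, t)\<close>, whose Sobolev norm tends to zero, so that all derivatives up to
  the third depend on time continuously, uniformly in \<open>s\<close>.\<close>

theorem Sobolev_continuous_imp_C3:
  fixes x :: "real \<Rightarrow> real \<Rightarrow> 'a::euclidean_space"
  assumes L: "0 < L" and x: "\<And>t. t \<ge> 0 \<Longrightarrow> continuous_on UNIV (\<lambda>s. x s t)"
    and S: "Sobolev_continuous L 4 (\<lambda>t s. x s t)"
  defines "a \<equiv> D\<^sub>s x" and "b \<equiv> D\<^sub>s (D\<^sub>s x)" and "c \<equiv> D\<^sub>s (D\<^sub>s (D\<^sub>s x))"
  shows "t \<ge> 0 \<Longrightarrow> ((\<lambda>s. x s t) has_vector_derivative a s t) (at s)"
    and "t \<ge> 0 \<Longrightarrow> ((\<lambda>s. a s t) has_vector_derivative b s t) (at s)"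
    and "t \<ge> 0 \<Longrightarrow> ((\<lambda>s. b s t) has_vector_derivative c s t) (at s)"
    and "y \<in> {x, a, b, c} \<Longrightarrow> continuous_on half_plane (\<lambda>(s, t). y s t)"
proof -
  have mem: "(\<lambda>s. x s t) \<in> Sobolev L 4" if "t \<ge> 0" for t
    using S that by (simp add: Sobolev_continuous_def)
  define N where "N = (\<lambda>\<tau> t. Sobolev_const L * Sobolev_norm L 4 (\<lambda>s. x s \<tau> - x s t))"
  have N: "((\<lambda>\<tau>. N \<tau> t) \<longlongrightarrow> 0) (at t within {0..})" if "t \<ge> 0" for t
    using S that unfolding N_def Sobolev_continuous_def by (auto intro: tendsto_mult_right_zero)
  have slice: "(\<forall>s. ((\<lambda>s. x s t) has_vector_derivative a s t) (at s)) \<and>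
      (\<forall>s. ((\<lambda>s. a s t) has_vector_derivative b s t) (at s)) \<and>
      (\<forall>s. ((\<lambda>s. b s t) has_vector_derivative c s t) (at s)) \<and> continuous_on UNIV (\<lambda>s. c s t)"
    if t: "t \<ge> 0" for t
  proof -
    obtain f1 f2 f3 where d: "\<And>s. ((\<lambda>s. x s t) has_vector_derivative f1 s) (at s)"
      "\<And>s. (f1 has_vector_derivative f2 s) (at s)" "\<And>s. (f2 has_vector_derivative f3 s) (at s)"
      "continuous_on UNIV f3"
      by (rule Sobolev_embedding[OF L x[OF t] mem[OF t]]) (rule that)
    have a: "(\<lambda>s. a s t) = f1" using d(1) by (auto simp: a_def D\<^sub>s_def intro: vector_derivative_at)
    have b: "(\<lambda>s. b s t) = f2" using d(2) a[unfolded a_def] by (auto simp: b_def D\<^sub>s_def[of "D\<^sub>s x"] intro: vector_derivative_at)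
    have c: "(\<lambda>s. c s t) = f3" using d(3) b[unfolded b_def] by (auto simp: c_def D\<^sub>s_def[of "D\<^sub>s (D\<^sub>s x)"] intro: vector_derivative_at)
    show ?thesis using d a b c by (metis (no_types, lifting))
  qed
  show 1: "t \<ge> 0 \<Longrightarrow> ((\<lambda>s. x s t) has_vector_derivative a s t) (at s)"
    and 2: "t \<ge> 0 \<Longrightarrow> ((\<lambda>s. a s t) has_vector_derivative b s t) (at s)"
    and 3: "t \<ge> 0 \<Longrightarrow> ((\<lambda>s. b s t) has_vector_derivative c s t) (at s)" for s t
    using slice by blast+
  have diff: "norm (y s \<tau> - y s t) \<le> N \<tau> t" if y: "y \<in> {x, a, b, c}" and t: "0 \<le> t" "0 \<le> \<tau>" for y s t \<tau>
  proof -
    obtain f1 f2 f3 where d: "\<And>s. ((\<lambda>s. x s \<tau> - x s t) has_vector_derivative f1 s) (at s)"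
      "\<And>s. (f1 has_vector_derivative f2 s) (at s)" "\<And>s. (f2 has_vector_derivative f3 s) (at s)"
      "continuous_on UNIV f3"
      and bd: "\<And>s h. h \<in> {\<lambda>s. x s \<tau> - x s t, f1, f2, f3} \<Longrightarrow>
        norm (h s) \<le> Sobolev_const L * Sobolev_norm L 4 (\<lambda>s. x s \<tau> - x s t)"
      by (rule Sobolev_embedding[OF L continuous_on_diff[OF x[OF t(2)] x[OF t(1)]]
            Sobolev_diff[OF L mem[OF t(2)] mem[OF t(1)]]]) (rule that)
    have a: "f1 = (\<lambda>s. a s \<tau> - a s t)"
      using d(1) has_vector_derivative_diff[OF 1[OF t(2)] 1[OF t(1)]] vector_derivative_unique_at by blast
    have b: "f2 = (\<lambda>s. b s \<tau> - b s t)"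
      using d(2) has_vector_derivative_diff[OF 2[OF t(2)] 2[OF t(1)]] vector_derivative_unique_at unfolding a by blast
    have c: "f3 = (\<lambda>s. c s \<tau> - c s t)"
      using d(3) has_vector_derivative_diff[OF 3[OF t(2)] 3[OF t(1)]] vector_derivative_unique_at unfolding b by blast
    show ?thesis
      using y bd[of "\<lambda>s. x s \<tau> - x s t" s] bd[of f1 s] bd[of f2 s] bd[of f3 s] unfolding a b c N_def by auto
  qed
  have "continuous_on UNIV (\<lambda>s. y s t)" if "y \<in> {x, a, b, c}" "t \<ge> 0" for y t
    using that slice[OF that(2)] x[OF that(2)]
    by (auto intro!: continuous_at_imp_continuous_on intro: has_vector_derivative_continuous
      simp: continuous_on_eq_continuous_at)
  then show "y \<in> {x, a, b, c} \<Longrightarrow> continuous_on half_plane (\<lambda>(s, t). y s t)"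
    by (intro continuous_on_half_plane[of y N] diff N)
qed

section \<open>Conservation of energy for classical filaments\<close>

lemma bounded_bilinear_cross3: "bounded_bilinear cross3"
  using bilinear_cross bilinear_conv_bounded_bilinear by blast

lemma norm_cross3_le: "norm (x \<times> y) \<le> norm x * norm y"
proof -
  have "(norm (x \<times> y))\<^sup>2 \<le> (norm x * norm y)\<^sup>2"
    unfolding norm_cross power_mult_distrib by simp
  then show ?thesis by (rule power2_le_imp_le) simp
qed

text \<open>A solution seen with classical derivatives only: \<open>a\<close>, \<open>b\<close> and \<open>c\<close> are the first, second and third
  derivative of \<open>x\<close> in \<open>s\<close>. Differentiability in time is assumed for \<open>x\<close> alone; for \<open>a\<close> it is derived,
  and for \<open>b\<close> it is not available, because it would need a fourth derivative in \<open>s\<close>.\<close>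

locale classical_filament =
  fixes L :: real and x a b c :: "real \<Rightarrow> real \<Rightarrow> real^3"
  assumes L_pos: "0 < L"
    and x_s: "0 \<le> t \<Longrightarrow> ((\<lambda>s. x s t) has_vector_derivative a s t) (at s)"
    and a_s: "0 \<le> t \<Longrightarrow> ((\<lambda>s. a s t) has_vector_derivative b s t) (at s)"
    and b_s: "0 \<le> t \<Longrightarrow> ((\<lambda>s. b s t) has_vector_derivative c s t) (at s)"
    and x_periodic: "0 \<le> t \<Longrightarrow> periodic L (\<lambda>s. x s t)"
    and x_cont: "continuous_on half_plane (\<lambda>(s, t). x s t)"
    and a_cont: "continuous_on half_plane (\<lambda>(s, t). a s t)"
    and b_cont: "continuous_on half_plane (\<lambda>(s, t). b s t)"
    and c_cont: "continuous_on half_plane (\<lambda>(s, t). c s t)"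
    and arclength: "0 \<le> t \<Longrightarrow> norm (a s t) = 1"
    and filament_eq: "0 < t \<Longrightarrow> ((\<lambda>\<tau>. x s \<tau>) has_vector_derivative a s t \<times> b s t) (at t)"
begin

lemma a_periodic: "0 \<le> t \<Longrightarrow> periodic L (\<lambda>s. a s t)"
  using periodic_derivative[OF x_periodic x_s] .

lemma b_periodic: "0 \<le> t \<Longrightarrow> periodic L (\<lambda>s. b s t)"
  using periodic_derivative[OF a_periodic a_s] .

lemma cont_compose:
  assumes "continuous_on half_plane (\<lambda>(s, t). y s t)"
    and "continuous_on A f" "continuous_on A g" "\<And>p. p \<in> A \<Longrightarrow> 0 \<le> g p"
  shows "continuous_on A (\<lambda>p. y (f p) (g p))"
proof -
  have "continuous_on A (\<lambda>p. (\<lambda>(s, t). y s t) (f p, g p))"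
    by (rule continuous_on_compose2[OF assms(1)]) (use assms in \<open>auto intro!: continuous_intros\<close>)
  then show ?thesis by simp
qed

lemmas cont = cont_compose[OF x_cont] cont_compose[OF a_cont] cont_compose[OF b_cont] cont_compose[OF c_cont]

text \<open>This is the differentiated equation \<open>a_t = a \<times> c\<close> in integrated form: the equation for \<open>x\<close> is
  integrated over \<open>[t, \<tau>]\<close> and differentiated in \<open>s\<close> under the integral sign, where the term \<open>b \<times> b\<close>
  drops out.\<close>

lemma tangent_flow:
  assumes "0 \<le> t" "t \<le> \<tau>"
  shows "((\<lambda>\<sigma>. a s \<sigma> \<times> c s \<sigma>) has_integral (a s \<tau> - a s t)) {t..\<tau>}"
proof -
  have x_diff: "x s \<tau> - x s t = integral (cbox t \<tau>) (\<lambda>\<sigma>. a s \<sigma> \<times> b s \<sigma>)" for s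
  proof -
    have "((\<lambda>\<sigma>. a s \<sigma> \<times> b s \<sigma>) has_integral (x s \<tau> - x s t)) {t..\<tau>}"
      by (rule fundamental_theorem_of_calculus_interior) (use assms in \<open>auto intro!: cont continuous_intros filament_eq\<close>)
    then show ?thesis by (simp add: integral_unique)
  qed
  have "((\<lambda>s. integral (cbox t \<tau>) (\<lambda>\<sigma>. a s \<sigma> \<times> b s \<sigma>)) has_vector_derivative
      integral (cbox t \<tau>) (\<lambda>\<sigma>. a s \<sigma> \<times> c s \<sigma>)) (at s within UNIV)"
  proof (rule leibniz_rule_vector_derivative)
    show "((\<lambda>s. a s \<sigma> \<times> b s \<sigma>) has_vector_derivative a s \<sigma> \<times> c s \<sigma>) (at s within UNIV)"
      if "\<sigma> \<in> cbox t \<tau>" for s \<sigma>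
      using bounded_bilinear.has_vector_derivative[OF bounded_bilinear_cross3 a_s b_s, of \<sigma> \<sigma> s] that assms
      by simp
    show "(\<lambda>\<sigma>. a s \<sigma> \<times> b s \<sigma>) integrable_on cbox t \<tau>" for s
      by (rule integrable_continuous) (use assms in \<open>auto intro!: cont continuous_on_cross continuous_intros\<close>)
    show "continuous_on (SIGMA s:UNIV. cbox t \<tau>) (\<lambda>(s, \<sigma>). a s \<sigma> \<times> c s \<sigma>)"
      unfolding case_prod_unfold
      by (intro continuous_on_cross cont continuous_intros) (use assms in auto)
  qed auto
  moreover have "((\<lambda>s. x s \<tau> - x s t) has_vector_derivative a s \<tau> - a s t) (at s)"
    using assms by (intro has_vector_derivative_diff x_s) auto
  ultimately have "a s \<tau> - a s t = integral {t..\<tau>} (\<lambda>\<sigma>. a s \<sigma> \<times> c s \<sigma>)"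
    unfolding x_diff by (auto intro: vector_derivative_unique_at)
  moreover have "(\<lambda>\<sigma>. a s \<sigma> \<times> c s \<sigma>) integrable_on {t..\<tau>}"
    by (rule integrable_continuous_real) (use assms in \<open>auto intro!: cont continuous_on_cross continuous_intros\<close>)
  ultimately show ?thesis by (simp add: has_integral_integrable_integral)
qed

lemma tangent_velocity:
  assumes "t \<in> {0..T}"
  shows "((\<lambda>\<tau>. a s \<tau>) has_vector_derivative a s t \<times> c s t) (at t within {0..T})"
proof -
  have flow: "((\<lambda>\<tau>. a s 0 + integral {0..\<tau>} (\<lambda>\<sigma>. a s \<sigma> \<times> c s \<sigma>)) has_vector_derivative 0 + a s t \<times> c s t) (at t within {0..T})"
    by (intro has_vector_derivative_add has_vector_derivative_const integral_has_vector_derivative assms)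
      (auto intro!: cont continuous_on_cross continuous_intros)
  have eq: "a s \<tau> = a s 0 + integral {0..\<tau>} (\<lambda>\<sigma>. a s \<sigma> \<times> c s \<sigma>)" if "\<tau> \<in> {0..T}" for \<tau>
    using tangent_flow[of 0 \<tau> s] that by (simp add: integral_unique)
  show ?thesis
    by (rule has_vector_derivative_transform[OF assms eq]) (use flow in simp_all)
qed

text \<open>Writing the difference of squares as a product and integrating by parts moves one derivative
  from \<open>b(\<tau>) - b(t)\<close> to the other factor. The increment of the energy is thereby expressed through
  the increment of \<open>a\<close>, whose time derivative exists.\<close>

lemma energy_increment:
  assumes "0 \<le> t" "0 \<le> \<tau>"
  shows "integral {0..L} (\<lambda>s. (norm (b s \<tau>))\<^sup>2) - integral {0..L} (\<lambda>s. (norm (b s t))\<^sup>2)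
    = - integral {0..L} (\<lambda>s. (c s \<tau> + c s t) \<bullet> (a s \<tau> - a s t))"
proof -
  have "integral {0..L} (\<lambda>s. (norm (b s \<tau>))\<^sup>2) - integral {0..L} (\<lambda>s. (norm (b s t))\<^sup>2)
      = integral {0..L} (\<lambda>s. (norm (b s \<tau>))\<^sup>2 - (norm (b s t))\<^sup>2)"
    using assms by (intro integral_diff[symmetric] integrable_continuous_real continuous_intros cont) auto
  also have "\<dots> = integral {0..L} (\<lambda>s. (b s \<tau> + b s t) \<bullet> (b s \<tau> - b s t))"
    by (intro integral_cong) (simp add: power2_norm_eq_inner inner_commute algebra_simps)
  also have "\<dots> = - integral {0..L} (\<lambda>s. (c s \<tau> + c s t) \<bullet> (a s \<tau> - a s t))"
    using assms a_periodic[of t] a_periodic[of \<tau>] b_periodic[of t] b_periodic[of \<tau>]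
    by (intro periodic_integration_by_parts[OF L_pos bounded_bilinear_inner])
      (auto simp: periodic_def intro!: has_vector_derivative_add has_vector_derivative_diff a_s b_s continuous_intros cont)
  finally show ?thesis .
qed

lemma c_time_modulus:
  assumes "0 < e"
  obtains d where "0 < d"
    "\<And>s \<sigma> \<tau>. s \<in> {0..L} \<Longrightarrow> \<sigma> \<in> {0..T} \<Longrightarrow> \<tau> \<in> {0..T} \<Longrightarrow> \<bar>\<sigma> - \<tau>\<bar> < d \<Longrightarrow> norm (c s \<sigma> - c s \<tau>) < e"
proof -
  have "uniformly_continuous_on (SIGMA s:{0..L}. {0..T}) (\<lambda>p. c (fst p) (snd p))"
    by (intro compact_uniformly_continuous compact_Times cont continuous_intros) auto
  then obtain d where d: "0 < d" "\<And>p q. p \<in> (SIGMA s:{0..L}. {0..T}) \<Longrightarrow> q \<in> (SIGMA s:{0..L}. {0..T}) \<Longrightarrow>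
      dist q p < d \<Longrightarrow> dist (c (fst q) (snd q)) (c (fst p) (snd p)) < e"
    using assms unfolding uniformly_continuous_on_def by meson
  show ?thesis
  proof (rule that[OF d(1)])
    fix s \<sigma> \<tau> assume "s \<in> {0..L}" "\<sigma> \<in> {0..T}" "\<tau> \<in> {0..T}" "\<bar>\<sigma> - \<tau>\<bar> < d"
    then show "norm (c s \<sigma> - c s \<tau>) < e"
      using d(2)[of "(s, \<tau>)" "(s, \<sigma>)"] by (simp add: dist_Pair_Pair dist_norm)
  qed
qed

text \<open>By \<open>tangent_flow\<close> the integrand of \<open>energy_increment\<close> is the integral of
  \<open>(c(\<tau>) + c(t)) \<bullet> (a(\<sigma>) \<times> c(\<sigma>))\<close> over \<open>\<sigma>\<close>. As \<open>c(\<sigma>)\<close> is perpendicular to \<open>a(\<sigma>) \<times> c(\<sigma>)\<close>, the two values of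
  \<open>c\<close> may be replaced by their differences to \<open>c(\<sigma>)\<close>, which are small. So the energy changes by
  \<open>o(\<tau> - t)\<close>.\<close>

lemma energy_almost_constant:
  assumes M: "\<And>s t. s \<in> {0..L} \<Longrightarrow> t \<in> {0..T} \<Longrightarrow> norm (c s t) \<le> M"
    and e: "\<And>s \<sigma> \<tau>. s \<in> {0..L} \<Longrightarrow> \<sigma> \<in> {0..T} \<Longrightarrow> \<tau> \<in> {0..T} \<Longrightarrow> \<bar>\<sigma> - \<tau>\<bar> < d \<Longrightarrow> norm (c s \<sigma> - c s \<tau>) < e"
    and t: "0 \<le> t" "t \<le> \<tau>" "\<tau> \<le> T" "\<tau> - t < d"
  shows "\<bar>integral {0..L} (\<lambda>s. (norm (b s \<tau>))\<^sup>2) - integral {0..L} (\<lambda>s. (norm (b s t))\<^sup>2)\<bar>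
    \<le> 2 * L * M * e * (\<tau> - t)"
proof -
  have pt: "norm ((c s \<tau> + c s t) \<bullet> (a s \<tau> - a s t)) \<le> 2 * M * e * (\<tau> - t)" if s: "s \<in> {0..L}" for s
  proof -
    let ?p = "\<lambda>\<sigma>. (c s \<tau> + c s t) \<bullet> (a s \<sigma> \<times> c s \<sigma>)"
    have p: "(?p has_integral (c s \<tau> + c s t) \<bullet> (a s \<tau> - a s t)) {t..\<tau>}"
      using has_integral_linear[OF tangent_flow[OF t(1,2)] bounded_linear_inner_right] by (simp add: o_def)
    have "norm (?p \<sigma>) \<le> 2 * M * e" if \<sigma>: "\<sigma> \<in> cbox t \<tau>" for \<sigma>
    proof -
      have "c s \<sigma> \<bullet> (a s \<sigma> \<times> c s \<sigma>) = 0" by (simp add: dot_cross_self)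
      then have eq: "?p \<sigma> = ((c s \<tau> - c s \<sigma>) + (c s t - c s \<sigma>)) \<bullet> (a s \<sigma> \<times> c s \<sigma>)"
        unfolding inner_add_left inner_diff_left by simp
      have "norm (c s \<tau> - c s \<sigma>) \<le> e" "norm (c s t - c s \<sigma>) \<le> e"
        using e[OF s, of \<tau> \<sigma>] e[OF s, of t \<sigma>] \<sigma> t by auto
      then have "norm ((c s \<tau> - c s \<sigma>) + (c s t - c s \<sigma>)) \<le> 2 * e"
        using norm_triangle_le[of "c s \<tau> - c s \<sigma>" "c s t - c s \<sigma>" "2 * e"] by simp
      moreover from this have "0 \<le> e" using order_trans[OF norm_ge_zero] by fastforce
      moreover have "norm (a s \<sigma> \<times> c s \<sigma>) \<le> 1 * M"
        using norm_cross3_le[of "a s \<sigma>" "c s \<sigma>"] arclength[of \<sigma> s] M[OF s, of \<sigma>] \<sigma> t by simp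
      ultimately have "norm (?p \<sigma>) \<le> (2 * e) * (1 * M)"
        unfolding eq by (intro order_trans[OF Cauchy_Schwarz_ineq2[folded real_norm_def]] mult_mono)
          (auto intro: order_trans[OF norm_ge_zero])
      then show ?thesis by (simp add: mult_ac)
    qed
    moreover have "0 \<le> 2 * M * e"
      using order_trans[OF norm_ge_zero M[OF s, of t]] e[OF s, of t t] t by (auto intro!: mult_nonneg_nonneg)
    ultimately show ?thesis
      using has_integral_bound[OF _ p[unfolded box_real(2)[symmetric]]] t by (simp add: content_real)
  qed
  have "norm (integral {0..L} (\<lambda>s. (c s \<tau> + c s t) \<bullet> (a s \<tau> - a s t))) \<le> (2 * M * e * (\<tau> - t)) * (L - 0)"
    using L_pos t pt by (intro integral_bound continuous_intros cont) auto
  then show ?thesis using energy_increment[of t \<tau>] t by (simp add: mult_ac)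
qed

theorem energy_conservation:
  assumes "0 \<le> T"
  shows "integral {0..L} (\<lambda>s. (norm (b s T))\<^sup>2) = integral {0..L} (\<lambda>s. (norm (b s 0))\<^sup>2)"
proof -
  define E where "E = (\<lambda>t. integral {0..L} (\<lambda>s. (norm (b s t))\<^sup>2))"
  have "compact ((\<lambda>p. c (fst p) (snd p)) ` (SIGMA s:{0..L}. {0..T}))"
    by (intro compact_continuous_image compact_Times cont continuous_intros) auto
  then obtain M0 where "\<And>p. p \<in> (SIGMA s:{0..L}. {0..T}) \<Longrightarrow> norm (c (fst p) (snd p)) \<le> M0"
    using compact_imp_bounded bounded_iff by (metis (no_types, lifting) imageI)
  then have M0: "norm (c s t) \<le> M0" if "s \<in> {0..L}" "t \<in> {0..T}" for s t using that by force
  \<comment> \<open>A positive bound, so that it may be divided by below.\<close>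
  define M where "M = max M0 1"
  have M: "norm (c s t) \<le> M" if "s \<in> {0..L}" "t \<in> {0..T}" for s t using M0[OF that] by (simp add: M_def)
  have LM: "0 < 2 * L * M" using L_pos by (simp add: M_def)
  have "(E has_vector_derivative 0) (at t within {0..T})" if t: "t \<in> {0..T}" for t
    unfolding has_vector_derivative_def has_derivative_within_alt
  proof (intro conjI allI impI)
    fix e :: real assume e: "0 < e"
    obtain d where d: "0 < d" "\<And>s \<sigma> \<tau>. s \<in> {0..L} \<Longrightarrow> \<sigma> \<in> {0..T} \<Longrightarrow> \<tau> \<in> {0..T} \<Longrightarrow> \<bar>\<sigma> - \<tau>\<bar> < d \<Longrightarrow>
        norm (c s \<sigma> - c s \<tau>) < e / (2 * L * M)"
      using c_time_modulus[of "e / (2 * L * M)" T] e LM by auto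
    have *: "\<bar>E \<tau> - E t\<bar> \<le> e * (\<tau> - t)" if "0 \<le> t" "t \<le> \<tau>" "\<tau> \<le> T" "\<tau> - t < d" for t \<tau>
    proof -
      have "2 * L * M * (e / (2 * L * M)) = e" using L_pos by (simp add: M_def)
      with energy_almost_constant[OF M d(2) that] show ?thesis by (simp only: E_def)
    qed
    show "\<exists>d>0. \<forall>y\<in>{0..T}. norm (y - t) < d \<longrightarrow> norm (E y - E t - (y - t) *\<^sub>R 0) \<le> e * norm (y - t)"
    proof (intro exI[of _ d] conjI d ballI impI)
      fix y assume y: "y \<in> {0..T}" "norm (y - t) < d"
      show "norm (E y - E t - (y - t) *\<^sub>R 0) \<le> e * norm (y - t)"
        using *[of t y] *[of y t] y t by (cases "t \<le> y") (auto simp: abs_minus_commute)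
    qed
  qed simp
  then obtain k where "\<And>t. t \<in> {0..T} \<Longrightarrow> E t = k"
    using has_vector_derivative_zero_constant[of "{0..T}" E] by auto
  then show ?thesis using assms by (simp add: E_def)
qed

end

section \<open>Uniqueness of the circular filament\<close>

definition circle_tangent :: "real \<Rightarrow> real \<Rightarrow> real^3" where
  "circle_tangent r s = cos (s / r) *\<^sub>R axis 2 1 - sin (s / r) *\<^sub>R axis 1 1"

definition circle_normal :: "real \<Rightarrow> real \<Rightarrow> real^3" where
  "circle_normal r s = - cos (s / r) *\<^sub>R axis 1 1 - sin (s / r) *\<^sub>R axis 2 1"

lemma circle_tangent_derivative:
  "(circle_tangent r has_vector_derivative circle_normal r s /\<^sub>R r) (at s)"
  unfolding circle_tangent_def[abs_def] circle_normal_def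
  by (auto intro!: derivative_eq_intros simp: has_vector_derivative_def[of _ "_ *\<^sub>R _"] algebra_simps divide_inverse)

lemma circle_normal_derivative:
  "(circle_normal r has_vector_derivative (- (1 / r)) *\<^sub>R circle_tangent r s) (at s)"
  unfolding circle_tangent_def circle_normal_def[abs_def]
  by (auto intro!: derivative_eq_intros simp: algebra_simps divide_inverse)

lemma circle_frame_norms [simp]: "norm (circle_tangent r s) = 1" "norm (circle_normal r s) = 1"
proof -
  have "(norm (circle_tangent r s))\<^sup>2 = 1" "(norm (circle_normal r s))\<^sup>2 = 1"
    unfolding power2_norm_eq_inner circle_tangent_def circle_normal_def
    by (simp_all add: inner_vec_def sum_3 axis_def power2_eq_square[symmetric])
  then show "norm (circle_tangent r s) = 1" "norm (circle_normal r s) = 1"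
    by (simp_all add: power2_eq_1_iff) (smt (verit) norm_ge_zero)+
qed

lemma circle_frame_cross: "circle_tangent r s \<times> circle_normal r s = axis 3 1"
  unfolding circle_tangent_def circle_normal_def
  by (simp add: cross3_def vec_eq_iff forall_3 axis_def power2_eq_square[symmetric])

lemma circle_frame_continuous: "continuous_on A (circle_tangent r)" "continuous_on A (circle_normal r)"
  using circle_tangent_derivative circle_normal_derivative
  by (meson continuous_at_imp_continuous_on has_vector_derivative_continuous)+

lemma gronwall_zero:
  fixes Z D :: "real \<Rightarrow> real"
  assumes T: "0 \<le> T" and Z: "\<And>t. t \<in> {0..T} \<Longrightarrow> (Z has_vector_derivative D t) (at t within {0..T})"
    and D: "\<And>t. t \<in> {0..T} \<Longrightarrow> D t \<le> k * Z t" and Z0: "Z 0 = 0"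
  shows "Z T \<le> 0"
proof -
  define W where "W = (\<lambda>t. exp (- k * t) * Z t)"
  have "W T \<le> W 0"
  proof (rule DERIV_nonpos_imp_decreasing_open[OF T])
    fix t assume t: "0 < t" "t < T"
    then have "(Z has_real_derivative D t) (at t)"
      using Z[of t] at_within_Icc_at[of 0 t T] by (simp add: has_real_derivative_iff_has_vector_derivative)
    then have "(W has_real_derivative exp (- k * t) * (D t - k * Z t)) (at t)"
      unfolding W_def by (auto intro!: derivative_eq_intros simp: algebra_simps)
    moreover have "exp (- k * t) * (D t - k * Z t) \<le> 0"
      using D[of t] t by (simp add: mult_nonneg_nonpos)
    ultimately show "\<exists>y. (W has_real_derivative y) (at t) \<and> y \<le> 0" by blast
  next
    have "continuous_on {0..T} Z"
      by (rule continuous_on_vector_derivative[OF Z])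
    then show "continuous_on {0..T} W" unfolding W_def by (intro continuous_intros)
  qed
  then show ?thesis using Z0 by (simp add: W_def mult_le_0_iff)
qed

context classical_filament
begin

text \<open>Here \<open>Z\<close> is the squared \<open>L\<^sup>2\<close> distance of the tangents. The fact \<open>W\<close> is the step at which
  conservation of energy enters, and \<open>D\<close> is the differential inequality for \<open>Z\<close>.\<close>

theorem circle_tangent_unique:
  assumes r: "0 < r" and per: "periodic L (circle_tangent r)"
    and init: "\<And>s. a s 0 = circle_tangent r s" and T: "0 \<le> T"
  shows "a s T = circle_tangent r s"
proof -
  let ?u = "circle_tangent r" and ?v = "circle_normal r"
  note u' = circle_tangent_derivative[of r] and v' = circle_normal_derivative[of r]
  have v_per: "periodic L ?v"
    using periodic_derivative[OF per u'] r by (simp add: periodic_def)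
  have b0: "b s 0 = ?v s /\<^sub>R r" for s
  proof -
    have "(\<lambda>s. a s 0) = ?u" using init by auto
    then show ?thesis using a_s[of 0 s] u'[of s] by (auto intro: vector_derivative_unique_at)
  qed
  note ci = integrable_continuous_real continuous_intros continuous_on_cross cont circle_frame_continuous
  define A where "A = (\<lambda>t. integral {0..L} (\<lambda>s. ?u s \<bullet> a s t))"
  define Z where "Z = (\<lambda>t. integral {0..L} (\<lambda>s. (norm (a s t - ?u s))\<^sup>2))"
  have Z_A: "Z t = 2 * L - 2 * A t" if t: "0 \<le> t" for t
  proof -
    have "Z t = integral {0..L} (\<lambda>s. 2 - 2 * (?u s \<bullet> a s t))"
      unfolding Z_def
    proof (rule integral_cong)
      fix s
      have "(norm (a s t - ?u s))\<^sup>2 = (norm (a s t))\<^sup>2 + (norm (?u s))\<^sup>2 - 2 * (?u s \<bullet> a s t)"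
        unfolding power2_norm_eq_inner by (simp add: inner_diff_left inner_diff_right inner_commute)
      then show "(norm (a s t - ?u s))\<^sup>2 = 2 - 2 * (?u s \<bullet> a s t)" using arclength[OF t] by simp
    qed
    also have "\<dots> = 2 * L - 2 * A t"
      unfolding A_def using L_pos t by (subst integral_diff) (auto intro!: ci)
    finally show ?thesis .
  qed
  have W: "integral {0..L} (\<lambda>s. (norm (b s t - ?v s /\<^sub>R r))\<^sup>2) = Z t / r\<^sup>2" if t: "0 \<le> t" for t
  proof -
    have "integral {0..L} (\<lambda>s. ?v s \<bullet> b s t) = - integral {0..L} (\<lambda>s. ((- (1 / r)) *\<^sub>R ?u s) \<bullet> a s t)"
      using t by (intro periodic_integration_by_parts[OF L_pos bounded_bilinear_inner]
          v_per v' a_periodic a_s ci) auto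
    also have "\<dots> = A t / r" by (simp add: A_def)
    finally have va: "integral {0..L} (\<lambda>s. ?v s \<bullet> b s t) = A t / r" .
    have energy: "integral {0..L} (\<lambda>s. (norm (b s t))\<^sup>2) = L / r\<^sup>2"
      using energy_conservation[OF t] b0 L_pos r by (simp add: power_divide divide_inverse power_mult_distrib power_inverse)
    have "integral {0..L} (\<lambda>s. (norm (b s t - ?v s /\<^sub>R r))\<^sup>2)
        = integral {0..L} (\<lambda>s. (norm (b s t))\<^sup>2 - (2 / r) * (?v s \<bullet> b s t) + 1 / r\<^sup>2)"
    proof (rule integral_cong)
      fix s
      have "(norm (b s t - ?v s /\<^sub>R r))\<^sup>2 = (norm (b s t))\<^sup>2 - (2 / r) * (?v s \<bullet> b s t) + (norm (?v s))\<^sup>2 / r\<^sup>2"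
        unfolding power2_norm_eq_inner using r
        by (simp add: inner_diff_left inner_diff_right inner_commute power2_eq_square del: circle_frame_norms)
          (simp add: field_simps)
      then show "(norm (b s t - ?v s /\<^sub>R r))\<^sup>2 = (norm (b s t))\<^sup>2 - (2 / r) * (?v s \<bullet> b s t) + 1 / r\<^sup>2" by simp
    qed
    also have "\<dots> = integral {0..L} (\<lambda>s. (norm (b s t))\<^sup>2 - (2 / r) * (?v s \<bullet> b s t)) + integral {0..L} (\<lambda>s. 1 / r\<^sup>2)"
      using t by (intro integral_add ci) auto
    also have "integral {0..L} (\<lambda>s. (norm (b s t))\<^sup>2 - (2 / r) * (?v s \<bullet> b s t))
        = L / r\<^sup>2 - (2 / r) * (A t / r)"
      using t r energy va by (subst integral_diff) (auto intro!: ci)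
    finally show ?thesis using Z_A[OF t] L_pos r by (simp add: field_simps power2_eq_square)
  qed
  have Z': "(Z has_vector_derivative - 2 * integral {0..L} (\<lambda>s. ?u s \<bullet> (a s t \<times> c s t))) (at t within {0..T})"
    if t: "t \<in> {0..T}" for t
  proof -
    have "((\<lambda>t. integral (cbox 0 L) (\<lambda>s. ?u s \<bullet> a s t)) has_vector_derivative
        integral (cbox 0 L) (\<lambda>s. ?u s \<bullet> (a s t \<times> c s t))) (at t within {0..T})"
    proof (rule leibniz_rule_vector_derivative)
      show "((\<lambda>t. ?u s \<bullet> a s t) has_vector_derivative ?u s \<bullet> (a s t \<times> c s t)) (at t within {0..T})"
        if "t \<in> {0..T}" for t s
        by (rule bounded_linear.has_vector_derivative[OF bounded_linear_inner_right tangent_velocity[OF that]])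
      show "(\<lambda>s. ?u s \<bullet> a s t) integrable_on cbox 0 L" if "t \<in> {0..T}" for t
        unfolding box_real(2) using that by (intro ci) auto
      show "continuous_on (SIGMA t:{0..T}. cbox 0 L) (\<lambda>(t, s). ?u s \<bullet> (a s t \<times> c s t))"
        unfolding case_prod_unfold
        by (intro ci continuous_on_compose2[OF circle_frame_continuous(1)[of UNIV]]) auto
    qed (use t in auto)
    then have "(A has_vector_derivative integral {0..L} (\<lambda>s. ?u s \<bullet> (a s t \<times> c s t))) (at t within {0..T})"
      by (simp add: A_def[abs_def])
    then have "((\<lambda>t. 2 * L - 2 * A t) has_vector_derivative - 2 * integral {0..L} (\<lambda>s. ?u s \<bullet> (a s t \<times> c s t))) (at t within {0..T})"
      by (auto intro!: derivative_eq_intros simp flip: has_real_derivative_iff_has_vector_derivative)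
    then show ?thesis
      by (rule has_vector_derivative_transform[OF t, rotated]) (use Z_A in auto)
  qed
  have D: "- 2 * integral {0..L} (\<lambda>s. ?u s \<bullet> (a s t \<times> c s t)) \<le> 2 / r\<^sup>2 * Z t" if t: "t \<in> {0..T}" for t
  proof -
    have t0: "0 \<le> t" using t by simp
    let ?z = "\<lambda>s. a s t - ?u s" and ?w = "\<lambda>s. b s t - ?v s /\<^sub>R r"
    have cr: "((\<lambda>s. a s t \<times> b s t) has_vector_derivative a s t \<times> c s t) (at s)" for s
      using bounded_bilinear.has_vector_derivative[OF bounded_bilinear_cross3 a_s[OF t0] b_s[OF t0]] by simp
    have cr_per: "periodic L (\<lambda>s. a s t \<times> b s t)"
      using a_periodic[OF t0] b_periodic[OF t0] by (simp add: periodic_def)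
    have "integral {0..L} (\<lambda>s. ?u s \<bullet> (a s t \<times> c s t)) = - integral {0..L} (\<lambda>s. (?v s /\<^sub>R r) \<bullet> (a s t \<times> b s t))"
      using t0 by (intro periodic_integration_by_parts[OF L_pos bounded_bilinear_inner] per u' cr_per cr ci) auto
    also have "integral {0..L} (\<lambda>s. (?v s /\<^sub>R r) \<bullet> (a s t \<times> b s t)) =
        integral {0..L} (\<lambda>s. (?v s \<bullet> (?z s \<times> ?w s)) / r - (?w s \<bullet> axis 3 1) / r)"
    proof (rule integral_cong)
      fix s
      \<comment> \<open>Expansion around the circle, with \<open>p\<close> the normal, \<open>m\<close> the tangent and \<open>q\<close>, \<open>y\<close> the perturbed tangent
          and curvature: the part of \<open>y\<close> along \<open>p\<close> drops out, and \<open>m \<times> p\<close> will be the vertical vector.\<close>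
      have "p \<bullet> (q \<times> y) = p \<bullet> ((q - m) \<times> (y - p /\<^sub>R r)) - (y - p /\<^sub>R r) \<bullet> (m \<times> p)" for p q y m :: "real^3"
        by (simp add: cross3_simps) 
      from this[of "?v s" "a s t" "b s t" "?u s"]
      have "?v s \<bullet> (a s t \<times> b s t) = ?v s \<bullet> (?z s \<times> ?w s) - ?w s \<bullet> axis 3 1"
        by (simp only: circle_frame_cross)
      then show "(?v s /\<^sub>R r) \<bullet> (a s t \<times> b s t) = (?v s \<bullet> (?z s \<times> ?w s)) / r - (?w s \<bullet> axis 3 1) / r"
        by (simp only: inner_scaleR_left right_diff_distrib divide_inverse mult.commute[of "inverse r"])
    qed
    also have "\<dots> = integral {0..L} (\<lambda>s. (?v s \<bullet> (?z s \<times> ?w s)) / r) - integral {0..L} (\<lambda>s. (?w s \<bullet> axis 3 1) / r)"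
      using t0 r by (intro integral_diff ci) auto
    also have "integral {0..L} (\<lambda>s. (?w s \<bullet> axis 3 1) / r) = 0"
    proof -
      have "((\<lambda>s. (?z s \<bullet> axis 3 1) / r) has_vector_derivative (?w s \<bullet> axis 3 1) / r) (at s)" for s
        using bounded_linear.has_vector_derivative[OF bounded_linear_inner_left
            has_vector_derivative_diff[OF a_s[OF t0] u'], THEN bounded_linear.has_vector_derivative[OF bounded_linear_divide]]
        by blast
      moreover have "periodic L (\<lambda>s. (?z s \<bullet> axis 3 1) / r)"
        using a_periodic[OF t0] per by (simp add: periodic_def)
      ultimately show ?thesis by (intro integral_unique integral_periodic_derivative[OF L_pos])
    qed
    finally have "- 2 * integral {0..L} (\<lambda>s. ?u s \<bullet> (a s t \<times> c s t)) = 2 * integral {0..L} (\<lambda>s. (?v s \<bullet> (?z s \<times> ?w s)) / r)"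
      by simp
    also have "\<dots> = integral {0..L} (\<lambda>s. 2 * ((?v s \<bullet> (?z s \<times> ?w s)) / r))" by simp
    also have "\<dots> \<le> integral {0..L} (\<lambda>s. (norm (?z s))\<^sup>2 / r\<^sup>2 + (norm (?w s))\<^sup>2)"
    proof (rule integral_le)
      fix s
      have "?v s \<bullet> (?z s \<times> ?w s) \<le> norm (?v s) * norm (?z s \<times> ?w s)" by (rule norm_cauchy_schwarz)
      also have "\<dots> \<le> norm (?z s) * norm (?w s)" using norm_cross3_le by simp
      finally have "2 * ((?v s \<bullet> (?z s \<times> ?w s)) / r) \<le> 2 * (norm (?z s) / r) * norm (?w s)"
        using r by (simp add: field_simps)
      also have "\<dots> \<le> (norm (?z s) / r)\<^sup>2 + (norm (?w s))\<^sup>2" by (rule sum_squares_bound)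
      finally show "2 * ((?v s \<bullet> (?z s \<times> ?w s)) / r) \<le> (norm (?z s))\<^sup>2 / r\<^sup>2 + (norm (?w s))\<^sup>2"
        by (simp add: power_divide)
    qed (use t0 r in \<open>auto intro!: ci\<close>)
    also have "\<dots> = Z t / r\<^sup>2 + Z t / r\<^sup>2"
      using t0 r W[OF t0] by (subst integral_add) (auto intro!: ci simp: Z_def)
    finally show ?thesis by simp
  qed
  have "Z 0 = 0" by (simp add: Z_def init)
  with gronwall_zero[of T Z, OF T Z' D] have "Z T \<le> 0" by blast
  moreover have "0 \<le> Z T" unfolding Z_def using T by (intro integral_nonneg ci) auto
  ultimately have "\<forall>s\<in>{0..L}. (norm (a s T - ?u s))\<^sup>2 = 0"
    using L_pos T unfolding Z_def by (subst integral_eq_0_iff[symmetric]) (auto intro!: ci)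
  then have "a s T = ?u s" if "s \<in> {0..L}" for s using that by simp
  then show ?thesis by (rule periodic_eqI[OF L_pos a_periodic[OF T] per])
qed

corollary circle_filament_unique:
  assumes r: "0 < r" and per: "periodic L (circle_tangent r)"
    and init: "\<And>s. a s 0 = circle_tangent r s" and t: "0 \<le> t"
  shows "x s t = x s 0 + (t / r) *\<^sub>R axis 3 1"
proof -
  have a: "(\<lambda>s. a s \<tau>) = circle_tangent r" if "0 \<le> \<tau>" for \<tau>
    using circle_tangent_unique[OF r per init that] by auto
  have b: "b s \<tau> = circle_normal r s /\<^sub>R r" if "0 \<le> \<tau>" for s \<tau>
    using a_s[OF that, of s] circle_tangent_derivative[of r s] a[OF that] by (auto intro: vector_derivative_unique_at)
  have "a s \<tau> \<times> b s \<tau> = (1 / r) *\<^sub>R axis 3 1" if "0 \<le> \<tau>" for \<tau>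
    using circle_tangent_unique[OF r per init that] b[OF that] circle_frame_cross[of r s]
    by (simp add: cross_mult_right divide_inverse)
  then have "((\<lambda>\<tau>. (1 / r) *\<^sub>R axis 3 1) has_integral (x s t - x s 0)) {0..t}"
    using filament_eq t
    by (intro fundamental_theorem_of_calculus_interior) (auto intro!: cont continuous_intros, metis less_imp_le)
  then have "x s t - x s 0 = t *\<^sub>R (1 / r) *\<^sub>R axis 3 1"
    using t by (simp add: has_integral_iff)
  then show ?thesis by (simp add: algebra_simps)
qed

end

section \<open>The gap to the circular filament\<close>

lemma is_solution_classical:
  assumes R: "0 < R" and sol: "is_solution R \<phi> x"
  shows "classical_filament (2 * pi * R) x (D\<^sub>s x) (D\<^sub>s (D\<^sub>s x)) (D\<^sub>s (D\<^sub>s (D\<^sub>s x)))"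
proof -
  define L where "L = 2 * pi * R"
  have L: "0 < L" using R by (simp add: L_def)
  have x: "\<And>t. 0 \<le> t \<Longrightarrow> continuous_on UNIV (\<lambda>s. x s t)"
    and unit: "\<And>s t. 0 \<le> t \<Longrightarrow> norm (D\<^sub>s x s t) = 1"
    and eq: "\<And>s t. 0 < t \<Longrightarrow> ((\<lambda>\<tau>. x s \<tau>) has_vector_derivative D\<^sub>s x s t \<times> D\<^sub>s (D\<^sub>s x) s t) (at t)"
    and "\<forall>j\<le>2. C_Sobolev L (4 - 2 * j) j (\<lambda>t s. x s t)"
    using sol unfolding is_solution_def L_def Let_def by blast+
  then have "C_Sobolev L (4 - 2 * 0) 0 (\<lambda>t s. x s t)" by blast
  then have S: "Sobolev_continuous L 4 (\<lambda>t s. x s t)" by simp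
  note C3 = Sobolev_continuous_imp_C3[OF L x S]
  have per: "periodic L (\<lambda>s. x s t)" if "0 \<le> t" for t
    using S that by (simp add: Sobolev_continuous_def Sobolev_def L2_circle_def)
  show ?thesis
    unfolding L_def[symmetric]
    by unfold_locales (use L C3 per unit eq in auto)
qed

theorem theorem4p4:
  fixes R :: real
  assumes "R > 0"
  shows "\<exists>C>0. \<forall>n\<ge>2. \<forall>x. is_solution R (initial_perturbation R n) x \<longrightarrow>
           (\<forall>s. \<forall>t\<ge>0. \<bar>x s t $ 3 - circle_filament R s t $ 3\<bar> = C * (real n - 1) * t)"
proof (intro exI[of _ "1 / R"] conjI allI impI)
  fix n :: nat and x s and t :: real
  assume n: "2 \<le> n" and sol: "is_solution R (initial_perturbation R n) x" and t: "0 \<le> t"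
  define r where "r = R / real n"
  have r: "0 < r" using assms n by (simp add: r_def)
  interpret classical_filament "2 * pi * R" x "D\<^sub>s x" "D\<^sub>s (D\<^sub>s x)" "D\<^sub>s (D\<^sub>s (D\<^sub>s x))"
    by (rule is_solution_classical[OF assms sol])
  have x0: "x s 0 = (r * cos (s / r)) *\<^sub>R axis 1 1 + (r * sin (s / r)) *\<^sub>R axis 2 1" for s
    using sol unfolding is_solution_def Let_def circle_filament_def initial_perturbation_def r_def[symmetric]
    by (simp add: vec_eq_iff forall_3 axis_def)
  have "((\<lambda>s. x s 0) has_vector_derivative circle_tangent r s) (at s)" for s
    unfolding x0 circle_tangent_def using r by (auto intro!: derivative_eq_intros)
  then have init: "D\<^sub>s x s 0 = circle_tangent r s" for s
    unfolding D\<^sub>s_def by (rule vector_derivative_at)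
  \<comment> \<open>One period of length \<open>2 * pi * R\<close> is \<open>n\<close> turns of the small circle; this closes up as \<open>n\<close> is an
    integer.\<close>
  have turns: "(s + 2 * pi * R) / r = s / r + real n * (2 * pi)" for s
    using assms n by (simp add: r_def field_simps)
  have "periodic (2 * pi * R) (circle_tangent r)"
    using sin.plus_of_nat[where 'a = real] cos.plus_of_nat[where 'a = real]
    unfolding periodic_def circle_tangent_def turns by simp
  from circle_filament_unique[OF r this init t, of s]
  have "x s t $ 3 = t / r" by (simp add: x0 axis_def)
  then have "x s t $ 3 - circle_filament R s t $ 3 = 1 / R * (real n - 1) * t"
    using assms n by (simp add: circle_filament_def r_def field_simps)
  moreover have "0 \<le> 1 / R * (real n - 1) * t" using assms n t by simp
  ultimately show "\<bar>x s t $ 3 - circle_filament R s t $ 3\<bar> = 1 / R * (real n - 1) * t"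
    by (simp only: abs_of_nonneg)
qed (use assms in simp)

end
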